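(* Let $d\ge 1$, let $X=T^d=[0,2\pi]^d$ and let $\psi\in\Psi$. Then the Fourier partial sum operators $s_M[\cdot]$ are uniformly bounded from the Orlicz space $L(N[\psi])$ into the Orlicz space $L(N_d[\psi])$: there is a finite constant $C=C(d,\psi)$ such that for all $f\in L(N[\psi])$ $$\sup_{M\ge 1}\|s_M[f]\|_{L(N_d[\psi])}\le C(d,\psi)\,\|f\|_{L(N[\psi])}.$$
   Context: $T^d=[0,2\pi]^d$ carries the normalized measure $dx=(2\pi)^{-d}\prod_{j=1}^d dx_j$. For measurable complex $f$ on $T^d$ and $n\in\mathbb Z^d$, $c(n)=\int_{T^d}e^{i(n,x)}f(x)\,dx$, $(n,x)=\sum_j n_jx_j$, $|n|=\max_j|n_j|$, and $s_M[f](x)=\sum_{n:|n|\le M}c(n)e^{-i(n,x)}$. Class $\Psi$: fix a number $\alpha_0\ge 1$; $\Psi$ is the set of continuous, finite, strictly increasing functions $\psi:[\alpha_0,\infty)\to(0,\infty)$ such that $p\mapsto p\log\psi(p)$ is convex and $\lim_{p\to\infty}\psi(p)=\infty$. For $\psi\in\Psi$ the function $N[\psi]=N([\psi],\cdot)$ is defined by $$N([\psi],u)=\exp\Big(\sup_{p\ge\alpha_0}\big(p\log|u|-p\log\psi(p)\big)\Big),\qquad |u|\ge e^2,$$ and on $[-e^2,e^2]$ it is defined arbitrarily, but so that $N([\psi],\cdot)$ is even, continuous, convex on $\mathbb R$, strictly increasing on $[0,\infty)$, and vanishes only at $0$. Further $\psi_d(p)=p^d\psi(p)$ (again in $\Psi$)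 and $N_d[\psi]=N[\psi_d]$. Orlicz norm on $(X,\mu)$ for such a function $N$: $\|f\|_{L(N)}=\inf_{v>0}\{v^{-1}(1+\int_X N(v|f(x)|)\,\mu(dx))\}$, and $L(N)$ is the space of measurable $f$ with finite norm. *)

theory Defs
  imports "HOL-Analysis.Analysis"
begin

subsection \<open>Fourier partial sums on the torus\<close>

definition torus :: "(real ^ 'd) measure" where
  "torus = scale_measure (ennreal (1 / (2 * pi) ^ CARD('d)))
             (lebesgue_on (cbox 0 (\<chi> i. 2 * pi)))"

definition pairing :: "int ^ 'd \<Rightarrow> real ^ 'd \<Rightarrow> real" where
  "pairing n x = (\<Sum>j\<in>UNIV. real_of_int (n $ j) * x $ j)"

definition max_abs :: "int ^ 'd \<Rightarrow> int" where
  "max_abs n = Max (range (\<lambda>j. \<bar>n $ j\<bar>))"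

text \<open>The sign convention is \<open>+\<close> in the coefficients and \<open>-\<close> in the partial sums.\<close>

definition fourier_coeff :: "(real ^ 'd \<Rightarrow> complex) \<Rightarrow> int ^ 'd \<Rightarrow> complex" where
  "fourier_coeff f n = (LINT x|torus. exp (\<i> * of_real (pairing n x)) * f x)"

definition partial_sum :: "nat \<Rightarrow> (real ^ 'd \<Rightarrow> complex) \<Rightarrow> real ^ 'd \<Rightarrow> complex" where
  "partial_sum M f x =
     (\<Sum>n | max_abs n \<le> int M. fourier_coeff f n * exp (- (\<i> * of_real (pairing n x))))"

lemma finite_max_abs_le: "finite {n :: int ^ 'd. max_abs n \<le> int M}"
proof -
  have "{n :: int ^ 'd. max_abs n \<le> int M}
          \<subseteq> vec_lambda ` (UNIV \<rightarrow>\<^sub>E {- int M .. int M})"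
  proof
    fix n :: "int ^ 'd"
    assume "n \<in> {n. max_abs n \<le> int M}"
    then have "\<bar>n $ j\<bar> \<le> int M" for j
      by (simp add: max_abs_def)
    then have "vec_nth n \<in> UNIV \<rightarrow>\<^sub>E {- int M .. int M}"
      by (force simp: abs_le_iff)
    then show "n \<in> vec_lambda ` (UNIV \<rightarrow>\<^sub>E {- int M .. int M})"
      by (metis image_eqI vec_nth_inverse)
  qed
  then show ?thesis
    by (rule finite_subset) (intro finite_imageI finite_PiE, auto)
qed

subsection \<open>The class $\Psi$ and the associated Young functions\<close>

text \<open>Only the values of \<open>\<psi>\<close> on \<open>[\<alpha>, \<infinity>)\<close> are relevant.\<close>

definition Psi_class :: "real \<Rightarrow> (real \<Rightarrow> real) set" where
  "Psi_class \<alpha> = {\<psi>. continuous_on {\<alpha>..} \<psi> \<and> (\<forall>p\<ge>\<alpha>. \<psi> p > 0) \<and>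
     strict_mono_on {\<alpha>..} \<psi> \<and> convex_on {\<alpha>..} (\<lambda>p. p * ln (\<psi> p)) \<and>
     filterlim \<psi> at_top at_top}"

definition psi_pow :: "nat \<Rightarrow> (real \<Rightarrow> real) \<Rightarrow> real \<Rightarrow> real" where
  "psi_pow d \<psi> p = p ^ d * \<psi> p"

text \<open>
  \<open>N[\<psi>]\<close> is prescribed only for \<open>\<bar>u\<bar> \<ge> e\<^sup>2\<close>, so it is rendered as the set of all its
  admissible versions. For \<open>\<psi> \<in> Psi_class \<alpha>\<close> with \<open>\<alpha> \<ge> 1\<close> the supremum is over a set bounded
  above, since \<open>\<psi>\<close> tends to infinity, and the linear interpolation on \<open>[0, e\<^sup>2]\<close> of the
  prescribed function is an admissible version.
\<close>

definition young_versions :: "real \<Rightarrow> (real \<Rightarrow> real) \<Rightarrow> (real \<Rightarrow> real) set" where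
  "young_versions \<alpha> \<psi> = {N.
     (\<forall>u. \<bar>u\<bar> \<ge> exp 2 \<longrightarrow> N u = exp (SUP p\<in>{\<alpha>..}. p * ln \<bar>u\<bar> - p * ln (\<psi> p))) \<and>
     (\<forall>u. N (- u) = N u) \<and> continuous_on UNIV N \<and> convex_on UNIV N \<and>
     strict_mono_on {0..} N \<and> (\<forall>u. N u = 0 \<longleftrightarrow> u = 0)}"

subsection \<open>Orlicz spaces\<close>

definition orlicz_norm :: "'a measure \<Rightarrow> (real \<Rightarrow> real) \<Rightarrow> ('a \<Rightarrow> complex) \<Rightarrow> ennreal" where
  "orlicz_norm \<mu> N f =
     (INF v\<in>{0<..}. (1 + (\<integral>\<^sup>+ x. ennreal (N (v * cmod (f x))) \<partial>\<mu>)) / ennreal v)"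

definition orlicz_space :: "'a measure \<Rightarrow> (real \<Rightarrow> real) \<Rightarrow> ('a \<Rightarrow> complex) set" where
  "orlicz_space \<mu> N = {f \<in> borel_measurable \<mu>. orlicz_norm \<mu> N f < \<infinity>}"

end

theory Submission imports Defs begin

text \<open>
  On \<open>L\<^sup>p\<close> of the torus with \<open>p\<close> a power of two, the operators \<open>s\<^sub>M\<close> have norm
  at most \<open>p\<^sup>d\<close>, uniformly in \<open>M\<close>. This is M. Riesz's theorem with the growth in \<open>p\<close> made explicit, one factor \<open>p\<close> for each
  coordinate: if \<open>u\<close> and \<open>v\<close> are polynomials with frequencies \<open>n\<^sub>j \<ge> 0\<close> and \<open>n\<^sub>j < 0\<close>, then Cotlar's
  identity \<open>(u - v)\<^sup>2 = 2 (u\<^sup>2 + v\<^sup>2) - (u + v)\<^sup>2\<close> lifts a bound of \<open>u - v\<close> by \<open>u + v\<close> from the exponent \<open>p\<close> to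
  \<open>2 p\<close> at the price of about doubling the constant (\<open>Lp_bounded_reflect\<close>). Half spaces, strips and boxes
  of frequencies follow algebraically, and Fejer means extend the bound to all functions
  (\<open>Lp_bounded_partial_sum\<close>).

  The Young function \<open>N[\<psi>]\<close> is the supremum over \<open>p\<close> of \<open>(u / \<psi> p)\<^sup>p\<close>, and the factor \<open>p\<^sup>d\<close> in \<open>\<psi>\<^sub>d\<close> matches the
  growth of the norms. Applying the \<open>L\<^sup>p\<close> bounds for each \<open>p\<close> separately and Chebyshev's inequality would
  yield only a tail estimate of order \<open>1 / N\<^sub>d\<close>, and for rapidly growing \<open>\<psi>\<close> such a tail need not make the integral
  of \<open>N\<^sub>d\<close> finite, whatever \<open>\<epsilon>\<close> scales its argument. The supremum is therefore divided into windows \<open>q \<le> p \<le> 2 q\<close> with \<open>q\<close> a power of two. The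
  supremum over one window behaves like a power between \<open>u\<^sup>q\<close> and \<open>u\<^bsup>2 q\<^esup>\<close>, so its modular can be
  interpolated between \<open>L\<^bsup>q / 2\<^esup>\<close> and \<open>L\<^bsup>4 q\<^esup>\<close> (\<open>nn_integral_dyadic_majorant_le\<close>) with constants of the form
  \<open>c\<^sup>q\<close>. A small factor \<open>\<epsilon>\<close> in the argument of \<open>N\<^sub>d\<close> beats these constants, and the sum over the windows converges
  (\<open>psi_pow_young_version_le\<close>, \<open>modular_bound\<close>): if the integral of \<open>N \<bar>f\<bar>\<close> is at most \<open>1\<close>, then that of
  \<open>N\<^sub>d (\<epsilon> \<bar>s\<^sub>M f\<bar>)\<close> is at most a constant \<open>K\<close>. By homogeneity the Orlicz norms compare with the constant
  \<open>(1 + K) / \<epsilon>\<close>.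
\<close>

section \<open>Minkowski and Cauchy--Schwarz without roots\<close>

text \<open>
  The inequality \<open>\<parallel>f\<parallel>\<^sub>p \<le> a\<close> is stated without a root and with the extended integral, so
  that it makes sense for every measurable function and bounds compose without extracting roots.
\<close>

definition Lp_bounded :: "'a measure \<Rightarrow> nat \<Rightarrow> ('a \<Rightarrow> complex) \<Rightarrow> real \<Rightarrow> bool" where
  "Lp_bounded M p f a \<longleftrightarrow>
     f \<in> borel_measurable M \<and> (\<integral>\<^sup>+x. ennreal (cmod (f x) ^ p) \<partial>M) \<le> ennreal (a ^ p)"

lemma Lp_bounded_measurable: "Lp_bounded M p f a \<Longrightarrow> f \<in> borel_measurable M"
  by (simp add: Lp_bounded_def)

lemma Lp_bounded_D: "Lp_bounded M p f a \<Longrightarrow> (\<integral>\<^sup>+x. ennreal (cmod (f x) ^ p) \<partial>M) \<le> ennreal (a ^ p)"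
  by (simp add: Lp_bounded_def)

text \<open>
  Convexity of \<open>r\<^sup>p\<close>, applied to \<open>(x + y) / (a + b)\<close> as the mean of \<open>x / a\<close> and \<open>y / b\<close> with weights
  proportional to \<open>a\<close> and \<open>b\<close>. With \<open>a\<close> and \<open>b\<close> the norms of two functions, integration turns this
  into Minkowski's inequality.
\<close>

lemma power_add_le_weighted:
  fixes x y a b :: real
  assumes "x \<ge> 0" "y \<ge> 0" "a > 0" "b > 0" "p \<ge> 1"
  shows "(x + y) ^ p \<le> (a + b) ^ (p - 1) * (a * (x / a) ^ p + b * (y / b) ^ p)"
proof -
  define t where "t = b / (a + b)"
  have t: "0 \<le> t" "t \<le> 1" "1 - t = a / (a + b)"
    using assms by (auto simp: t_def field_simps)
  have "((1 - t) *\<^sub>R (x / a) + t *\<^sub>R (y / b)) ^ p \<le> (1 - t) * (x / a) ^ p + t * (y / b) ^ p"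
    using assms t
    by (intro convex_onD[where A = "{0..}" and f = "\<lambda>x. x ^ p"])
      (cases "even p", auto intro: convex_power_odd convex_on_subset[OF convex_power_even])
  moreover have "(1 - t) *\<^sub>R (x / a) + t *\<^sub>R (y / b) = (x + y) / (a + b)"
    unfolding t(3) unfolding t_def using assms by (simp add: add_divide_distrib)
  ultimately have "(x + y) ^ p / (a + b) ^ p \<le> (a * (x / a) ^ p + b * (y / b) ^ p) / (a + b)"
    unfolding t(3) unfolding t_def by (simp only: power_divide[of "x + y"]) (simp add: add_divide_distrib)
  then have "(x + y) ^ p \<le> (a + b) ^ p * ((a * (x / a) ^ p + b * (y / b) ^ p) / (a + b))"
    using assms by (simp add: pos_divide_le_eq mult.commute)
  also have "(a + b) ^ p = (a + b) ^ (p - 1) * (a + b)"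
    using assms by (metis power_minus_mult less_le_trans zero_less_one)
  finally show ?thesis using assms by simp
qed

lemma Lp_bounded_add:
  assumes f: "Lp_bounded M p f a" and g: "Lp_bounded M p g b" and ab: "a > 0" "b > 0" and p: "p \<ge> 1"
  shows "Lp_bounded M p (\<lambda>x. f x + g x) (a + b)"
proof -
  note [measurable] = Lp_bounded_measurable[OF f] Lp_bounded_measurable[OF g]
  define A B where "A = (a + b) ^ (p - 1) * a / a ^ p" and "B = (a + b) ^ (p - 1) * b / b ^ p"
  have AB: "A \<ge> 0" "B \<ge> 0" using ab by (auto simp: A_def B_def)
  have "cmod (f x + g x) ^ p \<le> A * cmod (f x) ^ p + B * cmod (g x) ^ p" for x
  proof -
    have "cmod (f x + g x) ^ p \<le> (cmod (f x) + cmod (g x)) ^ p"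
      by (intro power_mono norm_triangle_ineq) auto
    also have "\<dots> \<le> (a + b) ^ (p - 1) * (a * (cmod (f x) / a) ^ p + b * (cmod (g x) / b) ^ p)"
      using ab p by (intro power_add_le_weighted) auto
    finally show ?thesis by (simp add: A_def B_def field_simps power_divide)
  qed
  then have "(\<integral>\<^sup>+x. ennreal (cmod (f x + g x) ^ p) \<partial>M)
      \<le> (\<integral>\<^sup>+x. ennreal A * ennreal (cmod (f x) ^ p) + ennreal B * ennreal (cmod (g x) ^ p) \<partial>M)"
    using AB by (intro nn_integral_mono) (simp flip: ennreal_mult' ennreal_plus)
  also have "\<dots> = ennreal A * (\<integral>\<^sup>+x. ennreal (cmod (f x) ^ p) \<partial>M) + ennreal B * (\<integral>\<^sup>+x. ennreal (cmod (g x) ^ p) \<partial>M)"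
    by (simp add: nn_integral_add nn_integral_cmult)
  also have "\<dots> \<le> ennreal A * ennreal (a ^ p) + ennreal B * ennreal (b ^ p)"
    by (intro add_mono mult_left_mono Lp_bounded_D f g) auto
  also have "\<dots> = ennreal (A * a ^ p + B * b ^ p)"
    using AB ab by (simp flip: ennreal_mult' ennreal_plus)
  also have "A * a ^ p + B * b ^ p = (a + b) ^ (p - 1) * (a + b)"
    using ab by (simp add: A_def B_def algebra_simps)
  also have "\<dots> = (a + b) ^ p"
    using p by (metis power_minus_mult less_le_trans zero_less_one)
  finally show ?thesis by (simp add: Lp_bounded_def)
qed

lemma Lp_bounded_scale:
  assumes f: "Lp_bounded M p f a"
  shows "Lp_bounded M p (\<lambda>x. c * f x) (cmod c * a)"
proof -
  note [measurable] = Lp_bounded_measurable[OF f]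
  have "(\<integral>\<^sup>+x. ennreal (cmod (c * f x) ^ p) \<partial>M) = ennreal (cmod c ^ p) * (\<integral>\<^sup>+x. ennreal (cmod (f x) ^ p) \<partial>M)"
    by (subst nn_integral_cmult[symmetric]) (auto simp: norm_mult power_mult_distrib ennreal_mult)
  also have "\<dots> \<le> ennreal (cmod c ^ p) * ennreal (a ^ p)"
    by (intro mult_left_mono Lp_bounded_D f) auto
  finally show ?thesis
    by (simp add: Lp_bounded_def power_mult_distrib ennreal_mult')
qed

lemma Lp_bounded_cong_norm:
  assumes "Lp_bounded M p f a" "g \<in> borel_measurable M" "\<And>x. cmod (g x) = cmod (f x)"
  shows "Lp_bounded M p g a"
  using assms by (simp add: Lp_bounded_def)

text \<open>
  Cauchy--Schwarz. The pointwise inequality of the two means is weighted so that both terms integrate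
  to \<open>(a b)\<^sup>p / 2\<close>.
\<close>

lemma Lp_bounded_mult:
  assumes f: "Lp_bounded M (2 * p) f a" and g: "Lp_bounded M (2 * p) g b" and ab: "a > 0" "b > 0"
  shows "Lp_bounded M p (\<lambda>x. f x * g x) (a * b)"
proof -
  note [measurable] = Lp_bounded_measurable[OF f] Lp_bounded_measurable[OF g]
  define A B where "A = b ^ p / a ^ p / 2" and "B = a ^ p / b ^ p / 2"
  have AB: "A \<ge> 0" "B \<ge> 0" using ab by (auto simp: A_def B_def)
  have "cmod (f x * g x) ^ p \<le> A * cmod (f x) ^ (2 * p) + B * cmod (g x) ^ (2 * p)" for x
  proof -
    define s t where "s = cmod (f x) ^ p" and "t = cmod (g x) ^ p"
    have "0 \<le> (b ^ p * s - a ^ p * t)\<^sup>2" by simp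
    then have "2 * (b ^ p * s) * (a ^ p * t) \<le> (b ^ p * s)\<^sup>2 + (a ^ p * t)\<^sup>2"
      by (simp add: power2_diff algebra_simps)
    then have "s * t \<le> A * s\<^sup>2 + B * t\<^sup>2"
      using ab by (simp add: A_def B_def field_simps power2_eq_square)
    then show ?thesis
      by (simp add: s_def t_def norm_mult power_mult_distrib power_even_eq)
  qed
  then have "(\<integral>\<^sup>+x. ennreal (cmod (f x * g x) ^ p) \<partial>M)
      \<le> (\<integral>\<^sup>+x. ennreal A * ennreal (cmod (f x) ^ (2 * p)) + ennreal B * ennreal (cmod (g x) ^ (2 * p)) \<partial>M)"
    using AB by (intro nn_integral_mono) (simp flip: ennreal_mult' ennreal_plus)
  also have "\<dots> = ennreal A * (\<integral>\<^sup>+x. ennreal (cmod (f x) ^ (2 * p)) \<partial>M) + ennreal B * (\<integral>\<^sup>+x. ennreal (cmod (g x) ^ (2 * p)) \<partial>M)"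
    by (simp add: nn_integral_add nn_integral_cmult)
  also have "\<dots> \<le> ennreal A * ennreal (a ^ (2 * p)) + ennreal B * ennreal (b ^ (2 * p))"
    by (intro add_mono mult_left_mono Lp_bounded_D f g) auto
  also have "\<dots> = ennreal (A * a ^ (2 * p) + B * b ^ (2 * p))"
    using AB ab by (simp flip: ennreal_mult' ennreal_plus)
  also have "A * a ^ (2 * p) + B * b ^ (2 * p) = (a * b) ^ p"
    using ab by (simp add: A_def B_def power_mult_distrib power_even_eq power2_eq_square)
  finally show ?thesis by (simp add: Lp_bounded_def)
qed

lemma Lp_bounded_square:
  assumes "Lp_bounded M (2 * p) f a"
  shows "Lp_bounded M p (\<lambda>x. (f x)\<^sup>2) (a\<^sup>2)"
  using assms by (auto simp: Lp_bounded_def norm_power simp flip: power_mult)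

section \<open>The torus and its characters\<close>

lemma scale_measure_eq_density: "scale_measure r M = density M (\<lambda>_. r)"
  by (rule measure_eqI) (auto simp: emeasure_density nn_integral_cmult)

abbreviation torus_box :: "(real ^ 'd) set" where
  "torus_box \<equiv> cbox 0 (\<chi> i. 2 * pi)"

lemma space_torus [simp]: "space (torus :: (real ^ 'd) measure) = torus_box"
  by (simp add: torus_def space_scale_measure)

lemma borel_measurable_torus:
  assumes "f \<in> borel_measurable borel"
  shows "f \<in> borel_measurable (torus :: (real ^ 'd) measure)"
  unfolding torus_def scale_measure_eq_density
  using assms by (auto intro!: measurable_restrict_space1 measurable_completion)

lemma integral_torus:
  fixes f :: "real ^ 'd \<Rightarrow> complex"
  assumes [measurable]: "f \<in> borel_measurable borel"
  shows "(LINT x|torus. f x) = (1 / (2 * pi) ^ CARD('d)) *\<^sub>R (LINT x|lborel. indicator torus_box x *\<^sub>R f x)"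
proof -
  have [measurable]: "f \<in> borel_measurable (lebesgue_on torus_box)"
    by (auto intro!: measurable_restrict_space1 measurable_completion)
  have "(LINT x|torus. f x) = (LINT x|lebesgue_on torus_box. (1 / (2 * pi) ^ CARD('d)) *\<^sub>R f x)"
    unfolding torus_def scale_measure_eq_density
    by (rule integral_density) auto
  also have "\<dots> = (1 / (2 * pi) ^ CARD('d)) *\<^sub>R (LINT x|lebesgue. indicator torus_box x *\<^sub>R f x)"
    by (simp add: integral_restrict_space)
  also have "(LINT x|lebesgue. indicator torus_box x *\<^sub>R f x) = (LINT x|lborel. indicator torus_box x *\<^sub>R f x)"
    by (rule integral_completion) measurable
  finally show ?thesis .
qed

lemma emeasure_torus: "emeasure (torus :: (real ^ 'd) measure) (space torus) = 1"
proof -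
  have "emeasure lborel (torus_box :: (real ^ 'd) set) = ennreal (\<Prod>b\<in>(Basis :: (real ^ 'd) set). 2 * pi)"
  proof (subst emeasure_lborel_cbox)
    have "((\<chi> i. 2 * pi) - 0) \<bullet> b = 2 * pi" if "b \<in> Basis" for b :: "real ^ 'd"
      using that by (auto simp: Basis_vec_def inner_axis)
    then show "ennreal (prod ((\<bullet>) ((\<chi> i. 2 * pi) - 0)) (Basis :: (real ^ 'd) set)) = ennreal (\<Prod>b\<in>(Basis :: (real ^ 'd) set). 2 * pi)"
      by (intro arg_cong[of _ _ ennreal] prod.cong) auto
  qed (auto simp: Basis_vec_def inner_axis)
  then show ?thesis
    unfolding space_torus by (simp add: torus_def emeasure_restrict_space flip: ennreal_mult')
qed

lemma lborel_integral_prod: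
  fixes f :: "'d::finite \<Rightarrow> real \<Rightarrow> complex"
  assumes "\<And>j. integrable lborel (f j)"
  shows "(LINT x|(lborel :: (real ^ 'd) measure). (\<Prod>j\<in>UNIV. f j (x $ j))) = (\<Prod>j\<in>UNIV. LINT t|lborel. f j t)"
proof -
  interpret product_sigma_finite "\<lambda>_::real ^ 'd. lborel :: real measure" ..
  have [measurable]: "f j \<in> borel_measurable borel" for j using assms[of j] by simp
  define ax where "ax = (\<lambda>j::'d. axis j (1::real))"
  have inj: "inj ax" by (auto simp: inj_on_def ax_def axis_eq_axis)
  have B: "Basis = range ax" by (auto simp: ax_def Basis_vec_def)
  define h where "h = (\<lambda>b. f (inv ax b))"
  have h: "h (ax j) = f j" for j using inj by (simp add: h_def)
  have "(LINT x|(lborel :: (real ^ 'd) measure). (\<Prod>j\<in>UNIV. f j (x $ j))) = (LINT x|lborel. (\<Prod>b\<in>Basis. h b (x \<bullet> b)))"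
    unfolding B using inj by (simp add: prod.reindex h) (simp add: ax_def inner_axis)
  also have "\<dots> = (LINT x|(\<Pi>\<^sub>M b\<in>Basis. lborel). (\<Prod>b\<in>Basis. h b (x b)))"
  proof -
    let ?G = "\<lambda>x::real ^ 'd. \<Prod>b\<in>Basis. h b (x \<bullet> b)"
    have "(LINT x|lborel. ?G x) = (LINT x|distr (\<Pi>\<^sub>M b\<in>Basis. lborel) borel (\<lambda>f. \<Sum>b\<in>Basis. f b *\<^sub>R b). ?G x)"
      by (rule arg_cong[where f = "\<lambda>M. integral\<^sup>L M ?G", OF lborel_eq])
    also have "\<dots> = (LINT x|(\<Pi>\<^sub>M b\<in>Basis. lborel). ?G (\<Sum>b\<in>Basis. x b *\<^sub>R b))"
      by (rule integral_distr) (auto simp: h_def)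
    finally show ?thesis by simp
  qed
  also have "\<dots> = (\<Prod>b\<in>Basis. LINT t|lborel. h b t)"
    by (rule product_integral_prod) (auto simp: h_def assms)
  also have "\<dots> = (\<Prod>j\<in>UNIV. LINT t|lborel. f j t)"
    unfolding B using inj by (simp add: prod.reindex h)
  finally show ?thesis .
qed

definition character :: "int ^ 'd \<Rightarrow> real ^ 'd \<Rightarrow> complex" where
  "character n x = exp (- (\<i> * of_real (pairing n x)))"

lemma norm_character [simp]: "cmod (character n x) = 1"
  by (simp add: character_def)

lemma character_0 [simp]: "character 0 x = 1"
  by (simp add: character_def pairing_def)

lemma character_add: "character (m + n) x = character m x * character n x"
  by (simp add: character_def pairing_def exp_add[symmetric] sum.distrib algebra_simps)

lemma cnj_character: "cnj (character n x) = character (- n) x"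
  by (simp add: character_def exp_cnj pairing_def sum_negf)

lemma character_diff: "character (m - n) x = character m x * cnj (character n x)"
  using character_add[of m "- n" x] by (simp add: cnj_character)

lemma character_prod: "character n x = (\<Prod>j\<in>UNIV. exp (- (\<i> * of_real (real_of_int (n $ j) * x $ j))))"
  by (simp add: character_def pairing_def exp_sum[symmetric] sum_negf sum_distrib_left)

lemma character_borel: "character n \<in> borel_measurable borel"
  unfolding character_def[abs_def] pairing_def[abs_def] by measurable

lemma character_torus [measurable]: "character n \<in> borel_measurable torus"
  by (rule borel_measurable_torus[OF character_borel])

lemma integral_exp_period:
  "(LINT t|lborel. indicator {0..2*pi} t *\<^sub>R exp (- (\<i> * of_real (real_of_int k * t)))) = (if k = 0 then 2 * of_real pi else 0)"
proof (cases "k = 0")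
  case True
  then show ?thesis by (simp add: measure_def scaleR_conv_of_real)
next
  case False
  define F where "F = (\<lambda>t. exp (- (\<i> * of_real (real_of_int k * t))) / (- (\<i> * of_int k)))"
  have "(LBINT t:{0..2*pi}. exp (- (\<i> * of_real (real_of_int k * t)))) = F (2*pi) - F 0"
  proof (rule integral_FTC_atLeastAtMost[unfolded set_lebesgue_integral_def[symmetric]])
    show "0 \<le> 2 * pi" by simp
    show "(F has_vector_derivative exp (- (\<i> * of_real (real_of_int k * x)))) (at x within {0..2 * pi})" for x
      unfolding F_def using False
      by (auto intro!: derivative_eq_intros has_vector_derivative_real_field simp: field_simps)
    show "continuous_on {0..2 * pi} (\<lambda>t. exp (- (\<i> * of_real (real_of_int k * t))))"
      by (intro continuous_intros)
  qed
  also have "F (2 * pi) = F 0"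
  proof -
    have "exp (- (\<i> * of_real (real_of_int k * (2 * pi)))) = exp (2 * of_real pi * \<i> * of_int (- k))"
      by (simp add: algebra_simps)
    also have "\<dots> = 1" using exp_integer_2pi[of "of_int (- k)"] by (simp add: ac_simps)
    finally show ?thesis by (simp add: F_def)
  qed
  finally show ?thesis using False by (simp add: set_lebesgue_integral_def)
qed

lemma integral_character: "(LINT x|(torus :: (real ^ 'd) measure). character n x) = (if n = 0 then 1 else 0)"
proof -
  define f where "f = (\<lambda>j t. indicator {0..2*pi} t *\<^sub>R exp (- (\<i> * of_real (real_of_int (n $ j) * t))))"
  have "indicator torus_box x *\<^sub>R character n x = (\<Prod>j\<in>UNIV. f j (x $ j))" for x
  proof -
    have "indicator torus_box x = (\<Prod>j\<in>UNIV. indicator {0..2*pi} (x $ j) :: real)"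
      by (auto simp: indicator_def mem_box_cart intro!: prod.neutral[symmetric])
    then show ?thesis
      by (simp add: character_prod f_def prod.distrib scaleR_conv_of_real)
  qed
  then have "(LINT x|lborel. indicator torus_box x *\<^sub>R character n x) = (\<Prod>j\<in>UNIV. LINT t|lborel. f j t)"
  proof (simp only:, intro lborel_integral_prod)
    fix j
    have "continuous_on {0..2*pi} (\<lambda>t. exp (- (\<i> * of_real (real_of_int (n $ j) * t))))"
      by (intro continuous_intros)
    then show "integrable lborel (f j)"
      unfolding f_def using borel_integrable_atLeastAtMost' by (simp add: set_integrable_def)
  qed
  also have "\<dots> = (\<Prod>j\<in>UNIV. if n $ j = 0 then 2 * of_real pi else 0)"
    unfolding f_def by (simp only: integral_exp_period)
  also have "\<dots> = (if n = 0 then (2 * of_real pi) ^ CARD('d) else 0)"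
    by (auto simp: vec_eq_iff)
  finally have *: "(LINT x|lborel. indicator torus_box x *\<^sub>R character n x) = \<dots>" .
  show ?thesis
    by (subst integral_torus, rule character_borel) (subst *, auto simp: scaleR_conv_of_real)
qed

section \<open>Cotlar's argument for a splitting of the frequencies\<close>

lemma finite_measure_torus: "finite_measure (torus :: (real ^ 'd) measure)"
  by (rule finite_measureI) (simp add: emeasure_torus del: space_torus)

text \<open>
  Trigonometric polynomials with frequencies in \<open>A\<close>, as functions rather than as coefficient families:
  the argument for half spaces below multiplies them and needs no more than the frequencies of
  a product, so convolution of coefficients never appears.
\<close>

inductive_set trig_polys :: "(int ^ 'd) set \<Rightarrow> (real ^ 'd \<Rightarrow> complex) set" for A where
  zero: "(\<lambda>_. 0) \<in> trig_polys A"
| add_term: "f \<in> trig_polys A \<Longrightarrow> n \<in> A \<Longrightarrow> (\<lambda>x. f x + c * character n x) \<in> trig_polys A"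

lemma trig_polys_measurable:
  assumes "f \<in> trig_polys A" shows "f \<in> borel_measurable torus"
  using assms by induction (auto intro!: borel_measurable_add borel_measurable_times character_torus)

lemma trig_polys_add:
  assumes "f \<in> trig_polys A" "g \<in> trig_polys A"
  shows "(\<lambda>x. f x + g x) \<in> trig_polys A"
  using assms(2)
proof induction
  case (add_term g n c)
  then show ?case
    using trig_polys.add_term[of "\<lambda>x. f x + g x" A n c] by (simp add: add.assoc)
qed (simp add: assms)

lemma trig_polys_scale:
  assumes "f \<in> trig_polys A" shows "(\<lambda>x. c * f x) \<in> trig_polys A"
  using assms
proof induction
  case (add_term f n c')
  then show ?case
    using trig_polys.add_term[of "\<lambda>x. c * f x" A n "c * c'"] by (simp add: algebra_simps)
qed (simp add: trig_polys.zero)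

lemma trig_polys_mult:
  assumes "f \<in> trig_polys A" "g \<in> trig_polys B" and AB: "\<And>a b. a \<in> A \<Longrightarrow> b \<in> B \<Longrightarrow> a + b \<in> C"
  shows "(\<lambda>x. f x * g x) \<in> trig_polys C"
proof -
  have 1: "(\<lambda>x. f x * character b x) \<in> trig_polys C" if "b \<in> B" for b
    using assms(1)
  proof induction
    case (add_term f n c)
    then show ?case
      using trig_polys.add_term[of "\<lambda>x. f x * character b x" C "n + b" c] AB[of n b] that
      by (simp add: distrib_right mult.assoc character_add)
  qed (simp add: trig_polys.zero)
  show ?thesis using assms(2)
  proof induction
    case (add_term g n c)
    then show ?case
      using trig_polys_add[OF _ trig_polys_scale[OF 1[of n], of c]]
      by (simp add: algebra_simps)
  qed (simp add: trig_polys.zero)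
qed

lemma trig_polys_sum:
  assumes "finite B" "\<And>n. n \<in> B \<Longrightarrow> h n \<in> A"
  shows "(\<lambda>x. \<Sum>n\<in>B. c n * character (h n) x) \<in> trig_polys A"
  using assms
proof (induction B rule: finite_induct)
  case (insert n B)
  then have "(\<lambda>x. (\<Sum>n\<in>B. c n * character (h n) x) + c n * character (h n) x) \<in> trig_polys A"
    by (intro trig_polys.add_term) auto
  then show ?case using insert by (simp add: add.commute)
qed (simp add: trig_polys.zero)

lemma trig_polys_cnj:
  assumes "f \<in> trig_polys A" shows "(\<lambda>x. cnj (f x)) \<in> trig_polys (uminus ` A)"
  using assms
proof induction
  case (add_term f n c)
  then show ?case
    using trig_polys.add_term[of "\<lambda>x. cnj (f x)" "uminus ` A" "- n" "cnj c"]
    by (simp add: cnj_character)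
qed (simp add: trig_polys.zero)

lemma trig_polys_bounded:
  assumes "f \<in> trig_polys A" shows "\<exists>K. \<forall>x. cmod (f x) \<le> K"
  using assms
proof induction
  case (add_term f n c)
  then obtain K where "\<And>x. cmod (f x) \<le> K" by blast
  then have "cmod (f x + c * character n x) \<le> K + cmod c" for x
    by (intro order_trans[OF norm_triangle_ineq] add_mono) (auto simp: norm_mult)
  then show ?case by blast
qed auto

lemma trig_polys_integrable:
  assumes "f \<in> trig_polys A" shows "integrable torus f"
proof -
  obtain K where "\<And>x. cmod (f x) \<le> K" using trig_polys_bounded[OF assms] by blast
  then show ?thesis
    by (intro finite_measure.integrable_const_bound[OF finite_measure_torus])
      (auto intro: trig_polys_measurable[OF assms])
qed

lemma integral_trig_poly_eq_0:
  assumes "f \<in> trig_polys A" "0 \<notin> A" shows "(LINT x|torus. f x) = 0"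
  using assms(1)
proof induction
  case (add_term f n c)
  have "integrable torus (\<lambda>x. c * character n x)"
    using trig_polys.add_term[OF trig_polys.zero, of n UNIV c]
    by (intro trig_polys_integrable[of _ UNIV]) auto
  then show ?case
    using add_term trig_polys_integrable[OF add_term(1)] assms(2)
    by (auto simp: integral_character)
qed simp

text \<open>
  Polynomials with disjoint frequency sets are orthogonal, so \<open>u + v\<close> and \<open>u - v\<close> have the same
  \<open>L\<^sup>2\<close> norm. This starts the induction over the exponents \<open>2\<^sup>k\<close>.
\<close>

lemma Lp_bounded_2_reflect:
  assumes u: "u \<in> trig_polys A" and v: "v \<in> trig_polys B" and AB: "A \<inter> B = {}"
    and f: "Lp_bounded torus 2 (\<lambda>x. u x + v x) a"
  shows "Lp_bounded torus 2 (\<lambda>x. u x - v x) a"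
proof -
  note [measurable] = trig_polys_measurable[OF u] trig_polys_measurable[OF v]
  have uv: "(\<lambda>x. u x * cnj (v x)) \<in> trig_polys (- {0})"
    using AB by (intro trig_polys_mult[OF u trig_polys_cnj[OF v]]) auto
  have int: "(LINT x|torus. u x * cnj (v x)) = 0"
    by (rule integral_trig_poly_eq_0[OF uv]) auto
  obtain K L where K: "\<And>x. cmod (u x) \<le> K" and L: "\<And>x. cmod (v x) \<le> L"
    using trig_polys_bounded[OF u] trig_polys_bounded[OF v] by blast
  have sq_int: "integrable torus (\<lambda>x. (cmod (w x))\<^sup>2)"
    if [measurable]: "w \<in> borel_measurable torus" and w: "\<And>x. cmod (w x) \<le> K + L" for w :: "real ^ 'b \<Rightarrow> complex"
    using w by (intro finite_measure.integrable_const_bound[OF finite_measure_torus, of _ "(K + L)\<^sup>2"])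
      (auto intro!: power_mono AE_I2)
  have i1: "integrable torus (\<lambda>x. (cmod (u x + v x))\<^sup>2)"
    by (rule sq_int) (measurable, rule order_trans[OF norm_triangle_ineq add_mono[OF K L]])
  have i2: "integrable torus (\<lambda>x. (cmod (u x - v x))\<^sup>2)"
    by (rule sq_int) (measurable, rule order_trans[OF norm_triangle_ineq4 add_mono[OF K L]])
  have "(cmod (u x - v x))\<^sup>2 = (cmod (u x + v x))\<^sup>2 - 4 * Re (u x * cnj (v x))" for x
    unfolding cmod_power2 by (simp add: power2_eq_square algebra_simps)
  then have "(LINT x|torus. (cmod (u x - v x))\<^sup>2) = (LINT x|torus. (cmod (u x + v x))\<^sup>2 - 4 * Re (u x * cnj (v x)))"
    by simp
  also have "\<dots> = (LINT x|torus. (cmod (u x + v x))\<^sup>2) - 4 * Re (LINT x|torus. u x * cnj (v x))"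
    using trig_polys_integrable[OF uv] i1
    by (subst Bochner_Integration.integral_diff) (auto simp del: times_complex.sel)
  finally have "(LINT x|torus. (cmod (u x - v x))\<^sup>2) = (LINT x|torus. (cmod (u x + v x))\<^sup>2)"
    by (simp add: int)
  then have "(\<integral>\<^sup>+x. ennreal ((cmod (u x - v x))\<^sup>2) \<partial>torus) = (\<integral>\<^sup>+x. ennreal ((cmod (u x + v x))\<^sup>2) \<partial>torus)"
    using i1 i2 by (simp add: nn_integral_eq_integral)
  then show ?thesis using f by (simp add: Lp_bounded_def)
qed

lemma Lp_bounded_mono:
  assumes "Lp_bounded M p f a" "0 \<le> a" "a \<le> b" shows "Lp_bounded M p f b"
  using assms unfolding Lp_bounded_def
  by (auto elim!: order_trans intro!: ennreal_leI power_mono)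

text \<open>
  Cotlar's argument. Write \<open>T\<close> for the passage from \<open>u + v\<close> to \<open>u - v\<close> and \<open>f = u + v\<close>. Since \<open>A\<close> and
  \<open>B\<close> are closed under addition, \<open>u\<^sup>2\<close> and \<open>- v\<^sup>2\<close> are again an admissible pair; their sum is \<open>f T f\<close>,
  so \<open>T (f T f) = u\<^sup>2 + v\<^sup>2\<close> and \<open>(T f)\<^sup>2 = 2 T (f T f) - f\<^sup>2\<close>. If \<open>c\<close> bounds \<open>T\<close> on \<open>L\<^sup>p\<close> and \<open>b\<close>, \<open>a\<close> are
  the \<open>L\<^bsup>2 p\<^esup>\<close> norms of \<open>T f\<close> and \<open>f\<close>, this gives \<open>b\<^sup>2 \<le> 2 c a b + a\<^sup>2\<close>, hence \<open>b \<le> (2 c + 1) a\<close>.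
  Starting from \<open>c = 1\<close> at \<open>p = 2\<close>, the constant \<open>p - 1\<close> reproduces itself at \<open>2 p\<close>, since \<open>2 (p - 1) + 1 = 2 p - 1\<close>.
  This is the linear growth in \<open>p\<close> on which the factor \<open>p\<^sup>d\<close> rests.
\<close>

lemma Lp_bounded_reflect:
  assumes A: "\<And>m n. m \<in> A \<Longrightarrow> n \<in> A \<Longrightarrow> m + n \<in> A"
    and B: "\<And>m n. m \<in> B \<Longrightarrow> n \<in> B \<Longrightarrow> m + n \<in> B"
    and AB: "A \<inter> B = {}"
    and "u \<in> trig_polys A" "v \<in> trig_polys B" "a > 0"
    and "Lp_bounded torus (2 ^ Suc k) (\<lambda>x. u x + v x) a"
  shows "Lp_bounded torus (2 ^ Suc k) (\<lambda>x. u x - v x) ((2 ^ Suc k - 1) * a)"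
  using assms(4-)
proof (induction k arbitrary: u v a)
  case 0
  then show ?case using Lp_bounded_2_reflect[OF 0(1,2) AB] by simp
next
  case (Suc k)
  define p :: nat where "p = 2 ^ Suc k"
  define c :: real where "c = 2 ^ Suc k - 1"
  have c: "c \<ge> 1" "2 ^ Suc (Suc k) - 1 = 2 * c + 1"
    using one_le_power[of "2::real" k] by (auto simp: c_def)
  have p: "p \<ge> 1" "2 ^ Suc (Suc k) = 2 * p" by (auto simp: p_def)
  note u = Suc.prems(1) and v = Suc.prems(2) and a = Suc.prems(3)
  have f: "Lp_bounded torus (2 * p) (\<lambda>x. u x + v x) a"
    using Suc.prems(4) unfolding p(2) .
  note [measurable] = trig_polys_measurable[OF u] trig_polys_measurable[OF v]
  obtain K L where K: "\<And>x. cmod (u x) \<le> K" and L: "\<And>x. cmod (v x) \<le> L"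
    using trig_polys_bounded[OF u] trig_polys_bounded[OF v] by blast
  define Y where "Y = (\<integral>\<^sup>+x. ennreal (cmod (u x - v x) ^ (2 * p)) \<partial>torus)"
  have "Y \<le> (\<integral>\<^sup>+x. ennreal ((K + L) ^ (2 * p)) \<partial>(torus :: (real ^ 'a) measure))"
    unfolding Y_def
    by (intro nn_integral_mono ennreal_leI power_mono order_trans[OF norm_triangle_ineq4 add_mono[OF K L]]) auto
  also have "\<dots> < \<infinity>" by (simp add: emeasure_torus del: space_torus)
  finally have Yfin: "Y < \<infinity>" .
  define b where "b = root (2 * p) (enn2real Y)"
  have b: "b \<ge> 0" "Y = ennreal (b ^ (2 * p))"
    using Yfin p(1) by (auto simp: b_def)
  have g: "Lp_bounded torus (2 * p) (\<lambda>x. u x - v x) b"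
    using b(2) by (simp add: Lp_bounded_def Y_def)
  \<comment> \<open>The norm of \<open>u - v\<close> is finite because polynomials are bounded, so the quadratic inequality may be solved for it.\<close>
  have "b \<le> (2 * c + 1) * a"
  proof (rule ccontr)
    assume "\<not> ?thesis"
    then have ba: "b > (2 * c + 1) * a" by simp
    have "(2 * c + 1) * a > 0" using c(1) a by simp
    with ba have b0: "b > 0" by linarith
    have u2: "(\<lambda>x. u x * u x) \<in> trig_polys A" by (rule trig_polys_mult[OF u u A])
    have v2: "(\<lambda>x. (- 1) * (v x * v x)) \<in> trig_polys B"
      by (intro trig_polys_scale trig_polys_mult[OF v v B])
    have "Lp_bounded torus p (\<lambda>x. (u x + v x) * (u x - v x)) (a * b)"
      by (rule Lp_bounded_mult[OF f g a b0])
    then have "Lp_bounded torus (2 ^ Suc k) (\<lambda>x. u x * u x + (- 1) * (v x * v x)) (a * b)"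
      by (simp add: p_def algebra_simps)
    from Suc.IH[OF u2 v2 _ this] a b0
    have "Lp_bounded torus p (\<lambda>x. u x * u x + v x * v x) (c * (a * b))"
      by (simp add: p_def c_def)
    from Lp_bounded_scale[OF this, of 2]
    have 1: "Lp_bounded torus p (\<lambda>x. 2 * (u x * u x + v x * v x)) (2 * (c * (a * b)))" by simp
    have "Lp_bounded torus p (\<lambda>x. - 1 * (u x + v x)\<^sup>2) (1 * a\<^sup>2)"
      using Lp_bounded_scale[OF Lp_bounded_square[OF f], of "- 1"] by simp
    from Lp_bounded_add[OF 1 this _ _ p(1)] a b0 c(1)
    have "Lp_bounded torus p (\<lambda>x. 2 * (u x * u x + v x * v x) + - 1 * (u x + v x)\<^sup>2) (2 * (c * (a * b)) + a\<^sup>2)"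
      by simp
    also have "(\<lambda>x. 2 * (u x * u x + v x * v x) + - 1 * (u x + v x)\<^sup>2) = (\<lambda>x. (u x - v x)\<^sup>2)"
      by (simp add: power2_eq_square algebra_simps fun_eq_iff)
    finally have "(\<integral>\<^sup>+x. ennreal (cmod ((u x - v x)\<^sup>2) ^ p) \<partial>torus) \<le> ennreal ((2 * (c * (a * b)) + a\<^sup>2) ^ p)"
      by (rule Lp_bounded_D)
    also have "(\<integral>\<^sup>+x. ennreal (cmod ((u x - v x)\<^sup>2) ^ p) \<partial>torus) = Y"
      by (simp add: Y_def norm_power flip: power_mult)
    finally have "b ^ (2 * p) \<le> (2 * (c * (a * b)) + a\<^sup>2) ^ p"
      unfolding b(2) using a b0 c(1) by (subst (asm) ennreal_le_iff) auto
    then have "(b\<^sup>2) ^ p \<le> (2 * (c * (a * b)) + a\<^sup>2) ^ p" by (simp add: power_mult)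
    then have "b\<^sup>2 \<le> 2 * (c * (a * b)) + a\<^sup>2"
      using p(1) a b0 c(1) by (subst (asm) power_mono_iff) auto
    moreover have "b * b > ((2 * c + 1) * a) * b" using ba b0 by simp
    moreover have "a * b \<ge> a * a"
      using ba a c(1) mult_right_mono[of 1 "2 * c + 1" a] by (intro mult_left_mono; linarith)
    ultimately show False by (simp add: power2_eq_square algebra_simps)
  qed
  from Lp_bounded_mono[OF g b(1) this] show ?case
    unfolding p(2) c(2) .
qed

section \<open>Restricting frequencies to half spaces, strips and boxes\<close>

lemma borel_measurable_cnj_comp [measurable (raw)]:
  "f \<in> borel_measurable M \<Longrightarrow> (\<lambda>x. cnj (f x)) \<in> borel_measurable M"
  by (rule measurable_compose[OF _ borel_measurable_continuous_onI]) (auto intro: continuous_intros)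

lemma Lp_bounded_modulate:
  assumes "Lp_bounded torus p f a"
  shows "Lp_bounded torus p (\<lambda>x. f x * character m x) a"
  by (rule Lp_bounded_cong_norm[OF assms])
    (auto simp: norm_mult intro!: borel_measurable_times character_torus Lp_bounded_measurable[OF assms])

text \<open>
  Modulation moves the threshold \<open>m\<close> to \<open>0\<close> without changing absolute values, and then the kept part is
  \<open>u = ((u + v) + (u - v)) / 2\<close>. The resulting constant \<open>(1 + (p - 1)) / 2 = p / 2\<close> makes the next step cost
  exactly \<open>p\<close>.
\<close>

lemma Lp_bounded_half_space:
  fixes c :: "int ^ 'd \<Rightarrow> complex"
  assumes B: "finite B" and a: "a > 0"
    and f: "Lp_bounded torus (2 ^ Suc k) (\<lambda>x. \<Sum>n\<in>B. c n * character n x) a"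
  shows "Lp_bounded torus (2 ^ Suc k) (\<lambda>x. \<Sum>n | n \<in> B \<and> m \<le> n $ j. c n * character n x) (2 ^ k * a)"
proof -
  \<comment> \<open>Subtracting \<open>s\<close> from all frequencies turns the threshold \<open>m\<close> in coordinate \<open>j\<close> into \<open>0\<close>.\<close>
  define s where "s = (axis j m :: int ^ 'd)"
  have s: "s $ j = m" by (simp add: s_def)
  define u v where "u = (\<lambda>x. \<Sum>n | n \<in> B \<and> m \<le> n $ j. c n * character (n - s) x)"
    and "v = (\<lambda>x. \<Sum>n | n \<in> B \<and> \<not> m \<le> n $ j. c n * character (n - s) x)"
  have u: "u \<in> trig_polys {n. 0 \<le> n $ j}" and v: "v \<in> trig_polys {n. n $ j < 0}"
    unfolding u_def v_def using B by (auto intro!: trig_polys_sum simp: s)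
  have shift: "character (n - s) x = character n x * character (- s) x" for n x
    using character_add[of n "- s" x] by simp
  have "u x + v x = (\<Sum>n\<in>B. c n * character n x) * character (- s) x" for x
  proof -
    have "(\<Sum>n\<in>B. c n * character (n - s) x) = u x + v x"
      unfolding u_def v_def using B
      by (subst sum.union_disjoint[symmetric]) (auto intro!: sum.cong)
    then show ?thesis by (simp add: shift sum_distrib_right mult.assoc)
  qed
  then have f': "Lp_bounded torus (2 ^ Suc k) (\<lambda>x. u x + v x) a"
    using Lp_bounded_modulate[OF f, of "- s"] by simp
  have g: "Lp_bounded torus (2 ^ Suc k) (\<lambda>x. u x - v x) ((2 ^ Suc k - 1) * a)"
    by (rule Lp_bounded_reflect[OF _ _ _ u v a f']) auto
  have "(1::real) < 2 ^ Suc k" by (rule one_less_power) auto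
  then have "Lp_bounded torus (2 ^ Suc k) (\<lambda>x. (u x + v x) + (u x - v x)) (a + (2 ^ Suc k - 1) * a)"
    by (intro Lp_bounded_add[OF f' g]) (use a in auto)
  then have "Lp_bounded torus (2 ^ Suc k) (\<lambda>x. 2 * u x) (2 * (2 ^ k * a))"
    by (simp add: algebra_simps)
  from Lp_bounded_modulate[OF Lp_bounded_scale[OF this, of "1 / 2"], of s]
  have "Lp_bounded torus (2 ^ Suc k) (\<lambda>x. u x * character s x) (2 ^ k * a)"
    by (simp add: norm_divide)
  moreover have "u x * character s x = (\<Sum>n | n \<in> B \<and> m \<le> n $ j. c n * character n x)" for x
    by (simp add: u_def sum_distrib_right mult.assoc flip: character_add)
  ultimately show ?thesis by simp
qed

text \<open>
  The strip is the difference of two half spaces. Intersecting two half spaces would compose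
  two projections and cost a factor of order \<open>p\<^sup>2\<close> instead of \<open>p\<close>.
\<close>

lemma Lp_bounded_strip:
  fixes c :: "int ^ 'd \<Rightarrow> complex"
  assumes B: "finite B" and a: "a > 0" and M: "0 \<le> M"
    and f: "Lp_bounded torus (2 ^ Suc k) (\<lambda>x. \<Sum>n\<in>B. c n * character n x) a"
  shows "Lp_bounded torus (2 ^ Suc k) (\<lambda>x. \<Sum>n | n \<in> B \<and> \<bar>n $ j\<bar> \<le> M. c n * character n x) (2 ^ Suc k * a)"
proof -
  let ?S = "\<lambda>m x. \<Sum>n | n \<in> B \<and> m \<le> n $ j. c n * character n x"
  have 1: "Lp_bounded torus (2 ^ Suc k) (?S (- M)) (2 ^ k * a)"
    by (rule Lp_bounded_half_space[OF B a f])
  have 2: "Lp_bounded torus (2 ^ Suc k) (\<lambda>x. - 1 * ?S (M + 1) x) (2 ^ k * a)"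
    using Lp_bounded_scale[OF Lp_bounded_half_space[OF B a f, of "M + 1" j], of "- 1"] by simp
  have "Lp_bounded torus (2 ^ Suc k) (\<lambda>x. ?S (- M) x + - 1 * ?S (M + 1) x) (2 ^ k * a + 2 ^ k * a)"
    using a by (intro Lp_bounded_add[OF 1 2]) auto
  moreover have "?S (- M) x = (\<Sum>n | n \<in> B \<and> \<bar>n $ j\<bar> \<le> M. c n * character n x) + ?S (M + 1) x" for x
    using B M by (subst sum.union_disjoint[symmetric]) (auto intro!: sum.cong)
  ultimately show ?thesis by (simp add: ac_simps)
qed

lemma Lp_bounded_box:
  fixes c :: "int ^ 'd \<Rightarrow> complex"
  assumes J: "finite J" and B: "finite B" and a: "a > 0" and M: "0 \<le> M"
    and f: "Lp_bounded torus (2 ^ Suc k) (\<lambda>x. \<Sum>n\<in>B. c n * character n x) a"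
  shows "Lp_bounded torus (2 ^ Suc k)
    (\<lambda>x. \<Sum>n | n \<in> B \<and> (\<forall>j\<in>J. \<bar>n $ j\<bar> \<le> M). c n * character n x) ((2 ^ Suc k) ^ card J * a)"
  using J
proof (induction J rule: finite_induct)
  case (insert j J)
  have "Lp_bounded torus (2 ^ Suc k)
      (\<lambda>x. \<Sum>n | n \<in> {n \<in> B. \<forall>j\<in>J. \<bar>n $ j\<bar> \<le> M} \<and> \<bar>n $ j\<bar> \<le> M. c n * character n x)
      (2 ^ Suc k * ((2 ^ Suc k) ^ card J * a))"
    by (rule Lp_bounded_strip[OF _ _ M insert.IH]) (use a B in auto)
  then show ?case using insert by (simp add: conj_ac ac_simps)
qed (use f in simp)

lemma max_abs_le_iff: "max_abs n \<le> K \<longleftrightarrow> (\<forall>j. \<bar>n $ j\<bar> \<le> K)"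
  by (auto simp: max_abs_def)

section \<open>From polynomials to functions by Fejer means\<close>

lemma fourier_coeff_eq: "fourier_coeff f n = (LINT x|torus. f x * cnj (character n x))"
  by (simp add: fourier_coeff_def character_def exp_cnj mult.commute)

lemma partial_sum_eq: "partial_sum M f x = (\<Sum>n | max_abs n \<le> int M. fourier_coeff f n * character n x)"
  by (simp add: partial_sum_def character_def)

text \<open>
  The tangent of \<open>r\<^sup>p\<close> at \<open>s\<close> lies below the graph. Integrated with \<open>s\<close> equal to the mean of \<open>t\<close>, it is Jensen's
  inequality for the \<open>p\<close>-th power.
\<close>

lemma power_tangent_le:
  fixes s t :: real
  assumes "s \<ge> 0" "t \<ge> 0" "p \<ge> 2"
  shows "s ^ p + real p * s ^ (p - 1) * (t - s) \<le> t ^ p"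
proof (cases "s = 0")
  case True
  then show ?thesis using assms by (simp add: power_0_left)
next
  case False
  with assms have s: "s > 0" by simp
  have "1 + real p * (t / s - 1) \<le> (1 + (t / s - 1)) ^ p"
    using assms s by (intro Bernoulli_inequality) auto
  then have "s ^ p * (1 + real p * (t / s - 1)) \<le> s ^ p * (t / s) ^ p"
    using s by (intro mult_left_mono) auto
  moreover have "s ^ p = s ^ (p - 1) * s"
    using assms by (metis power_minus_mult less_le_trans pos2)
  moreover have "s * (t / s - 1) = t - s" using s by (simp add: field_simps)
  then have "s ^ (p - 1) * s * (1 + real p * (t / s - 1)) = s ^ (p - 1) * s + real p * s ^ (p - 1) * (t - s)"
    by (simp only: distrib_left mult_1_right mult.assoc mult.left_commute[of s "real p"]) (simp only: ac_simps)
  ultimately show ?thesis using s by (simp add: power_divide)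
qed

lemma integrable_power_of_Lp_bounded:
  assumes f: "Lp_bounded M p f a"
  shows "integrable M (\<lambda>x. cmod (f x) ^ p)"
proof (rule integrableI_bounded)
  note [measurable] = Lp_bounded_measurable[OF f]
  show "(\<lambda>x. cmod (f x) ^ p) \<in> borel_measurable M" by measurable
  show "(\<integral>\<^sup>+ x. ennreal (norm (cmod (f x) ^ p)) \<partial>M) < \<infinity>"
    using Lp_bounded_D[OF f] by (simp add: le_less_trans ennreal_less_top)
qed

lemma (in finite_measure) integrable_of_Lp_bounded:
  assumes f: "Lp_bounded M p f a" and p: "p \<ge> 1"
  shows "integrable M f"
proof (rule Bochner_Integration.integrable_bound)
  note [measurable] = Lp_bounded_measurable[OF f]
  show "f \<in> borel_measurable M" by measurable
  show "integrable M (\<lambda>x. 1 + cmod (f x) ^ p)"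
    using integrable_power_of_Lp_bounded[OF f] by simp
  have "cmod (f x) \<le> 1 + cmod (f x) ^ p" for x
  proof (cases "cmod (f x) \<le> 1")
    case False
    then show ?thesis using power_increasing[of 1 p "cmod (f x)"] p by simp
  qed (simp add: add_increasing2)
  then show "AE x in M. norm (f x) \<le> norm (1 + cmod (f x) ^ p)"
    by (auto intro!: AE_I2 order_trans[OF _ abs_ge_self])
qed

text \<open>
  The polynomial bounds are carried over to arbitrary functions by convolution with a nonnegative
  kernel of mean one. For any finite nonempty set \<open>B\<close> of frequencies the normalised square modulus of a Dirichlet
  type kernel has these two properties; for cubes \<open>B\<close> it is the product of the Fejer kernels of
  the coordinates, evaluated at \<open>x - y\<close>.
\<close>

definition fejer_kernel :: "(int ^ 'd) set \<Rightarrow> real ^ 'd \<Rightarrow> real ^ 'd \<Rightarrow> real" where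
  "fejer_kernel B x y = (cmod (\<Sum>m\<in>B. character m x * cnj (character m y)))\<^sup>2 / real (card B)"

lemma fejer_kernel_nonneg: "0 \<le> fejer_kernel B x y"
  by (simp add: fejer_kernel_def)

lemma fejer_kernel_commute: "fejer_kernel B x y = fejer_kernel B y x"
proof -
  have "(\<Sum>m\<in>B. character m y * cnj (character m x)) = cnj (\<Sum>m\<in>B. character m x * cnj (character m y))"
    by (simp add: mult.commute)
  then show ?thesis unfolding fejer_kernel_def by (simp only: complex_mod_cnj)
qed

lemma of_real_fejer_kernel:
  "of_real (fejer_kernel B x y)
     = (\<Sum>m\<in>B. \<Sum>m'\<in>B. character (m - m') x * cnj (character (m - m') y)) / of_nat (card B)"
  unfolding fejer_kernel_def
  by (simp add: complex_norm_square sum_product character_diff ac_simps del: of_real_power)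

lemma fejer_kernel_le: "fejer_kernel B x y \<le> real (card B)"
proof -
  have "cmod (\<Sum>m\<in>B. character m x * cnj (character m y)) \<le> (\<Sum>m\<in>B. 1)"
    by (rule sum_norm_le) (simp add: norm_mult)
  then have "(cmod (\<Sum>m\<in>B. character m x * cnj (character m y)))\<^sup>2 \<le> (real (card B))\<^sup>2"
    by (intro power_mono) auto
  then show ?thesis
    by (cases "card B = 0") (auto simp: fejer_kernel_def power2_eq_square divide_simps)
qed

lemma fejer_kernel_measurable [measurable]:
  "(\<lambda>y. fejer_kernel B x y) \<in> borel_measurable torus"
  "(\<lambda>(x, y). fejer_kernel B x y) \<in> borel_measurable (torus \<Otimes>\<^sub>M torus)"
proof -
  note [measurable] = character_torus
  show "(\<lambda>y. fejer_kernel B x y) \<in> borel_measurable torus"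
    unfolding fejer_kernel_def by measurable
  show "(\<lambda>(x, y). fejer_kernel B x y) \<in> borel_measurable (torus \<Otimes>\<^sub>M torus)"
    unfolding fejer_kernel_def by measurable
qed

lemma integral_fejer_kernel:
  assumes B: "finite B" "B \<noteq> {}"
  shows "(LINT y|torus. fejer_kernel B x y) = 1"
proof -
  have int: "integrable torus (\<lambda>y. character (m - m') x * cnj (character (m - m') y))" for m m'
    using trig_polys.add_term[OF trig_polys.zero, of "m' - m" UNIV "character (m - m') x"]
    by (intro trig_polys_integrable[of _ UNIV]) (auto simp: cnj_character)
  have val: "(LINT y|torus. character (m - m') x * cnj (character (m - m') y)) = (if m = m' then 1 else 0)" for m m'
    by (auto simp: cnj_character integral_character)
  have sums: "(LINT y|torus. (\<Sum>m\<in>B. \<Sum>m'\<in>B. character (m - m') x * cnj (character (m - m') y)))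
      = (\<Sum>m\<in>B. \<Sum>m'\<in>B. (LINT y|torus. character (m - m') x * cnj (character (m - m') y)))"
    by (subst Bochner_Integration.integral_sum, intro Bochner_Integration.integrable_sum int)
      (intro sum.cong refl Bochner_Integration.integral_sum int)
  have "complex_of_real (LINT y|torus. fejer_kernel B x y)
      = (LINT y|torus. (\<Sum>m\<in>B. \<Sum>m'\<in>B. character (m - m') x * cnj (character (m - m') y)) / of_nat (card B))"
    by (simp only: integral_complex_of_real[symmetric] of_real_fejer_kernel)
  also have "\<dots> = (\<Sum>m\<in>B. \<Sum>m'\<in>B. if m = m' then 1 else 0) / of_nat (card B)"
    by (subst integral_divide_zero) (simp only: sums val)
  also have "\<dots> = 1"
    using B by simp
  finally show ?thesis by (simp only: of_real_eq_1_iff)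
qed

text \<open>
  The Fourier coefficient of the kernel: expanding the square counts the pairs of frequencies with
  difference \<open>n\<close>.
\<close>

definition fejer_multiplier :: "(int ^ 'd) set \<Rightarrow> int ^ 'd \<Rightarrow> real" where
  "fejer_multiplier B n = real (card {(m, m') \<in> B \<times> B. m - m' = n}) / real (card B)"

text \<open>
  Each kernel \<open>fejer_kernel B x\<close> is a probability density, so Jensen's inequality bounds the \<open>p\<close>-th power
  of the mean of \<open>f\<close> by the mean of \<open>\<bar>f\<bar>\<^sup>p\<close>. The density also has mean one in \<open>x\<close>, so after exchanging the
  integrals the mean of \<open>\<bar>f\<bar>\<^sup>p\<close> integrates to the integral of \<open>\<bar>f\<bar>\<^sup>p\<close>.
\<close>

lemma Lp_bounded_fejer_mean:
  fixes f :: "real ^ 'd \<Rightarrow> complex"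
  assumes B: "finite B" "B \<noteq> {}" and p: "p \<ge> 2" and f: "Lp_bounded torus p f a"
  shows "Lp_bounded torus p
    (\<lambda>x. \<Sum>n\<in>(\<lambda>(m, m'). m - m') ` (B \<times> B). fejer_multiplier B n * fourier_coeff f n * character n x) a"
proof -
  note [measurable] = Lp_bounded_measurable[OF f]
  interpret finite_measure "torus :: (real ^ 'd) measure" by (rule finite_measure_torus)
  have intf: "integrable torus f" by (rule integrable_of_Lp_bounded[OF f]) (use p in simp)
  have intp: "integrable torus (\<lambda>x. cmod (f x) ^ p)" by (rule integrable_power_of_Lp_bounded[OF f])
  have intK: "integrable torus (\<lambda>y. h y * fejer_kernel B x y)"
    if "integrable torus h" for h :: "real ^ 'd \<Rightarrow> real" and x
  proof (rule Bochner_Integration.integrable_bound[OF integrable_mult_right[OF that, of "card B"]])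
    note [measurable] = borel_measurable_integrable[OF that]
    show "(\<lambda>y. h y * fejer_kernel B x y) \<in> borel_measurable torus" by measurable
    have "\<bar>h y\<bar> * fejer_kernel B x y \<le> real (card B) * \<bar>h y\<bar>" for y
      using mult_left_mono[OF fejer_kernel_le[of B x y], of "\<bar>h y\<bar>"] by (simp add: mult.commute)
    then show "AE y in torus. norm (h y * fejer_kernel B x y) \<le> norm (real (card B) * h y)"
      by (auto simp: abs_mult fejer_kernel_nonneg)
  qed
  define G where "G = (\<lambda>x. \<Sum>n\<in>(\<lambda>(m, m'). m - m') ` (B \<times> B). fejer_multiplier B n * fourier_coeff f n * character n x)"
  have G: "G x = (LINT y|torus. f y * fejer_kernel B x y)" for x
  proof -
    have int: "integrable torus (\<lambda>y. f y * cnj (character n y))" for n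
    proof (rule Bochner_Integration.integrable_bound[OF intf])
      show "(\<lambda>y. f y * cnj (character n y)) \<in> borel_measurable torus"
        using character_torus[of n] by measurable
    qed (simp add: norm_mult)
    have "G x = (\<Sum>n\<in>(\<lambda>(m, m'). m - m') ` (B \<times> B). \<Sum>mm\<in>{mm \<in> B \<times> B. (case mm of (m, m') \<Rightarrow> m - m') = n}.
        (case mm of (m, m') \<Rightarrow> fourier_coeff f (m - m') * character (m - m') x / of_nat (card B)))"
      unfolding G_def
    proof (rule sum.cong[OF refl])
      fix n
      have "(\<Sum>mm\<in>{mm \<in> B \<times> B. (case mm of (m, m') \<Rightarrow> m - m') = n}.
          (case mm of (m, m') \<Rightarrow> fourier_coeff f (m - m') * character (m - m') x / of_nat (card B)))
        = (\<Sum>mm\<in>{mm \<in> B \<times> B. (case mm of (m, m') \<Rightarrow> m - m') = n}. fourier_coeff f n * character n x / of_nat (card B))"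
        by (rule sum.cong) auto
      also have "\<dots> = fejer_multiplier B n * fourier_coeff f n * character n x"
        by (simp add: fejer_multiplier_def case_prod_unfold mem_Times_iff conj_assoc)
      finally show "fejer_multiplier B n * fourier_coeff f n * character n x = (\<Sum>mm\<in>{mm \<in> B \<times> B. (case mm of (m, m') \<Rightarrow> m - m') = n}.
          (case mm of (m, m') \<Rightarrow> fourier_coeff f (m - m') * character (m - m') x / of_nat (card B)))" ..
    qed
    also have "\<dots> = (\<Sum>(m, m')\<in>B \<times> B. fourier_coeff f (m - m') * character (m - m') x / of_nat (card B))"
      using B by (intro sum.image_gen[symmetric]) auto
    also have "\<dots> = (\<Sum>m\<in>B. \<Sum>m'\<in>B. fourier_coeff f (m - m') * character (m - m') x / of_nat (card B))"
      by (rule sum.cartesian_product[symmetric])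
    also have "\<dots> = (\<Sum>m\<in>B. \<Sum>m'\<in>B. (LINT y|torus. f y * cnj (character (m - m') y) * (character (m - m') x / of_nat (card B))))"
      by (simp add: fourier_coeff_eq)
    also have "\<dots> = (LINT y|torus. (\<Sum>m\<in>B. \<Sum>m'\<in>B. f y * cnj (character (m - m') y) * (character (m - m') x / of_nat (card B))))"
      by (simp add: int del: complex_cnj_mult)
    also have "\<dots> = (LINT y|torus. f y * fejer_kernel B x y)"
      by (simp add: of_real_fejer_kernel sum_distrib_left sum_divide_distrib ac_simps)
    finally show ?thesis .
  qed
  have jensen: "cmod (G x) ^ p \<le> (LINT y|torus. cmod (f y) ^ p * fejer_kernel B x y)" for x
  proof -
    define s where "s = (LINT y|torus. cmod (f y) * fejer_kernel B x y)"
    have s0: "s \<ge> 0" unfolding s_def by (intro integral_nonneg_AE) (simp add: fejer_kernel_nonneg)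
    have "cmod (G x) \<le> (LINT y|torus. norm (f y * fejer_kernel B x y))"
      unfolding G by (rule integral_norm_bound)
    also have "\<dots> = s" by (simp add: s_def norm_mult fejer_kernel_nonneg)
    finally have Gs: "cmod (G x) \<le> s" .
    have i1: "integrable torus (\<lambda>y. cmod (f y) * fejer_kernel B x y)"
      by (intro intK integrable_norm intf)
    have i0: "integrable torus (\<lambda>y. fejer_kernel B x y)"
      using intK[of "\<lambda>_. 1" x] by simp
    have i2: "integrable torus (\<lambda>y. cmod (f y) ^ p * fejer_kernel B x y)"
      by (intro intK intp)
    let ?t = "real p * s ^ (p - 1)"
    have "s ^ p = (LINT y|torus. (s ^ p - ?t * s) * fejer_kernel B x y + ?t * (cmod (f y) * fejer_kernel B x y))"
      using i0 i1 by (simp add: integral_fejer_kernel[OF B] flip: s_def)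
    also have "\<dots> \<le> (LINT y|torus. cmod (f y) ^ p * fejer_kernel B x y)"
    proof (intro integral_mono)
      show "integrable torus (\<lambda>y. (s ^ p - ?t * s) * fejer_kernel B x y + ?t * (cmod (f y) * fejer_kernel B x y))"
        using i0 i1 by simp
      show "integrable torus (\<lambda>y. cmod (f y) ^ p * fejer_kernel B x y)" by (rule i2)
      fix y
      have "(s ^ p + ?t * (cmod (f y) - s)) * fejer_kernel B x y \<le> cmod (f y) ^ p * fejer_kernel B x y"
        by (intro mult_right_mono power_tangent_le fejer_kernel_nonneg) (use s0 p in auto)
      then show "(s ^ p - ?t * s) * fejer_kernel B x y + ?t * (cmod (f y) * fejer_kernel B x y) \<le> cmod (f y) ^ p * fejer_kernel B x y"
        by (simp add: algebra_simps)
    qed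
    finally show ?thesis using power_mono[OF Gs, of p] by simp
  qed
  have Gm: "G \<in> borel_measurable torus"
    unfolding G_def using character_torus by measurable
  interpret P: pair_sigma_finite "torus :: (real ^ 'd) measure" "torus :: (real ^ 'd) measure" ..
  have "(\<integral>\<^sup>+x. ennreal (cmod (G x) ^ p) \<partial>torus)
      \<le> (\<integral>\<^sup>+x. \<integral>\<^sup>+y. ennreal (cmod (f y) ^ p) * ennreal (fejer_kernel B x y) \<partial>torus \<partial>torus)"
  proof (rule nn_integral_mono)
    fix x
    have "ennreal (cmod (G x) ^ p) \<le> ennreal (LINT y|torus. cmod (f y) ^ p * fejer_kernel B x y)"
      using jensen by (rule ennreal_leI)
    also have "\<dots> = (\<integral>\<^sup>+y. ennreal (cmod (f y) ^ p * fejer_kernel B x y) \<partial>torus)"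
      by (rule nn_integral_eq_integral[symmetric]) (auto intro: intK[OF intp] simp: fejer_kernel_nonneg)
    finally show "ennreal (cmod (G x) ^ p) \<le> (\<integral>\<^sup>+y. ennreal (cmod (f y) ^ p) * ennreal (fejer_kernel B x y) \<partial>torus)"
      by (simp add: ennreal_mult fejer_kernel_nonneg)
  qed
  also have "\<dots> = (\<integral>\<^sup>+y. \<integral>\<^sup>+x. ennreal (cmod (f y) ^ p) * ennreal (fejer_kernel B x y) \<partial>torus \<partial>torus)"
    by (rule P.Fubini'[symmetric]) measurable
  also have "\<dots> = (\<integral>\<^sup>+y. ennreal (cmod (f y) ^ p) \<partial>torus)"
  proof (rule nn_integral_cong)
    fix y
    have "(\<integral>\<^sup>+x. ennreal (fejer_kernel B y x) \<partial>torus) = ennreal (LINT x|torus. fejer_kernel B y x)"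
      using intK[of "\<lambda>_. 1" y] by (intro nn_integral_eq_integral) (auto simp: fejer_kernel_nonneg)
    then show "(\<integral>\<^sup>+x. ennreal (cmod (f y) ^ p) * ennreal (fejer_kernel B x y) \<partial>torus) = ennreal (cmod (f y) ^ p)"
      unfolding fejer_kernel_commute[of B _ y]
      by (simp add: nn_integral_cmult integral_fejer_kernel[OF B])
  qed
  also have "\<dots> \<le> ennreal (a ^ p)" by (rule Lp_bounded_D[OF f])
  finally show ?thesis using Gm by (simp add: Lp_bounded_def G_def)
qed


lemma card_vec_box:
  fixes S :: "'d::finite \<Rightarrow> int set"
  shows "card {m :: int ^ 'd. \<forall>j. m $ j \<in> S j} = (\<Prod>j\<in>UNIV. card (S j))"
proof -
  have "bij_betw vec_nth {m :: int ^ 'd. \<forall>j. m $ j \<in> S j} (\<Pi>\<^sub>E j\<in>UNIV. S j)"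
    by (rule bij_betwI[where g = vec_lambda]) auto
  then show ?thesis
    using card_PiE[of UNIV S] by (simp add: bij_betw_same_card)
qed

definition int_cube :: "nat \<Rightarrow> (int ^ 'd) set" where
  "int_cube L = {m. \<forall>j. m $ j \<in> {0..<int L}}"

lemma card_int_cube: "card (int_cube L :: (int ^ 'd) set) = L ^ CARD('d)"
  unfolding int_cube_def by (subst card_vec_box) simp

text \<open>
  The pairs with difference \<open>n\<close> correspond to the points of the cube that stay in the cube when shifted
  by \<open>n\<close>, a box with sides \<open>L - \<bar>n\<^sub>j\<bar>\<close>, empty if one of these is negative.
\<close>

lemma fejer_multiplier_int_cube:
  "fejer_multiplier (int_cube L) n = (\<Prod>j\<in>UNIV. real (nat (int L - \<bar>n $ j\<bar>)) / real L)"
proof -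
  let ?B = "int_cube L :: (int ^ 'a) set"
  have "x \<in> {0..<int L} \<inter> {- k..<int L - k} \<longleftrightarrow> x \<in> {0..<int L} \<and> x + k \<in> {0..<int L}" for x k :: int
    by auto
  then have mem: "{m'. \<forall>j. m' $ j \<in> {0..<int L} \<inter> {- n $ j..<int L - n $ j}} = {m'. m' \<in> ?B \<and> m' + n \<in> ?B}"
    by (simp add: int_cube_def all_conj_distrib del: Int_iff atLeastLessThan_iff)
  have "bij_betw (\<lambda>m'. (m' + n, m')) {m'. \<forall>j. m' $ j \<in> {0..<int L} \<inter> {- n $ j..<int L - n $ j}}
      {(m, m') \<in> ?B \<times> ?B. m - m' = n}"
    unfolding mem by (rule bij_betwI[where g = snd]) auto
  then have "card {(m, m') \<in> ?B \<times> ?B. m - m' = n}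
      = card {m' :: int ^ 'a. \<forall>j. m' $ j \<in> {0..<int L} \<inter> {- n $ j..<int L - n $ j}}"
    by (rule bij_betw_same_card[symmetric])
  also have "\<dots> = (\<Prod>j\<in>UNIV. card ({0..<int L} \<inter> {- n $ j..<int L - n $ j}))"
    by (rule card_vec_box)
  also have "\<dots> = (\<Prod>j\<in>UNIV. nat (int L - \<bar>n $ j\<bar>))"
    by (intro prod.cong refl) (auto simp: Int_atLeastLessThan)
  finally show ?thesis
    by (simp add: fejer_multiplier_def card_int_cube prod_dividef)
qed

lemma fejer_multiplier_tendsto: "(\<lambda>L. fejer_multiplier (int_cube (Suc L)) n) \<longlonglongrightarrow> 1"
proof -
  have "(\<lambda>L. real (nat (int L - \<bar>k\<bar>)) / real L) \<longlonglongrightarrow> 1" for k :: int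
  proof -
    have "(\<lambda>L. 1 - real_of_int \<bar>k\<bar> / real L) \<longlonglongrightarrow> 1 - 0"
      by (intro tendsto_intros lim_const_over_n)
    moreover have "\<forall>\<^sub>F L in sequentially. 1 - real_of_int \<bar>k\<bar> / real L = real (nat (int L - \<bar>k\<bar>)) / real L"
      using eventually_gt_at_top[of "nat \<bar>k\<bar>"]
    proof eventually_elim
      case (elim L)
      then have "real (nat (int L - \<bar>k\<bar>)) = real L - real_of_int \<bar>k\<bar>" by simp
      then show ?case using elim by (simp add: diff_divide_distrib)
    qed
    ultimately show ?thesis by (simp add: tendsto_cong)
  qed
  then have "(\<lambda>L. fejer_multiplier (int_cube L) n) \<longlonglongrightarrow> (\<Prod>j\<in>(UNIV :: 'a set). 1)"
    unfolding fejer_multiplier_int_cube by (intro tendsto_prod)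
  then show ?thesis by (intro LIMSEQ_Suc) simp
qed

lemma partial_sum_measurable: "partial_sum M f \<in> borel_measurable torus"
proof -
  have "partial_sum M f = (\<lambda>x. \<Sum>n | max_abs n \<le> int M. fourier_coeff f n * character n x)"
    by (rule ext) (rule partial_sum_eq)
  then show ?thesis using character_torus by simp
qed

text \<open>
  The Fejer means of \<open>f\<close> are trigonometric polynomials with norm at most that of \<open>f\<close>, to which the bound
  for boxes applies. Their partial sums converge pointwise to that of \<open>f\<close>, as only finitely many coefficients
  with \<open>\<bar>n\<bar> \<le> M\<close> occur and each multiplier tends to \<open>1\<close>; Fatou's lemma keeps the bound in the limit.
\<close>

proposition Lp_bounded_partial_sum:
  fixes f :: "real ^ 'd \<Rightarrow> complex"
  assumes a: "a > 0" and f: "Lp_bounded torus (2 ^ Suc k) f a"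
  shows "Lp_bounded torus (2 ^ Suc k) (partial_sum M f) ((2 ^ Suc k) ^ CARD('d) * a)"
proof -
  let ?p = "2 ^ Suc k :: nat"
  let ?C = "((2 ^ Suc k) ^ CARD('d) * a) :: real"
  let ?N = "{n :: int ^ 'd. max_abs n \<le> int M}"
  define h where "h = (\<lambda>L x. \<Sum>n\<in>?N. fejer_multiplier (int_cube (Suc L)) n * fourier_coeff f n * character n x)"
  have h: "Lp_bounded torus ?p (h L) ?C" for L
  proof -
    let ?B = "int_cube (Suc L) :: (int ^ 'd) set"
    let ?D = "(\<lambda>(m, m'). m - m') ` (?B \<times> ?B)"
    have "card ?B > 0" by (simp add: card_int_cube)
    then have B: "finite ?B" "?B \<noteq> {}" unfolding card_gt_0_iff by blast+
    have "(2::nat) \<le> ?p" by simp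
    note * = Lp_bounded_fejer_mean[OF B this f]
    have "finite ?D" using B by auto
    from Lp_bounded_box[OF finite_class.finite_UNIV this a _ *, of "int M"]
    have "Lp_bounded torus ?p (\<lambda>x. \<Sum>n | n \<in> ?D \<and> max_abs n \<le> int M. fejer_multiplier ?B n * fourier_coeff f n * character n x) ?C"
      by (simp add: max_abs_le_iff)
    moreover have "(\<Sum>n | n \<in> ?D \<and> max_abs n \<le> int M. fejer_multiplier ?B n * fourier_coeff f n * character n x) = h L x" for x
      unfolding h_def
    proof (rule sum.mono_neutral_left)
      have "fejer_multiplier ?B n = 0" if "n \<notin> ?D" for n
      proof -
        have "{(m, m') \<in> ?B \<times> ?B. m - m' = n} = {}" using that by auto
        then show ?thesis unfolding fejer_multiplier_def by (simp only: card.empty of_nat_0 div_0)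
      qed
      then show "\<forall>n\<in>?N - {n \<in> ?D. max_abs n \<le> int M}. fejer_multiplier ?B n * fourier_coeff f n * character n x = 0"
        by auto
    qed (auto intro: finite_max_abs_le)
    ultimately show ?thesis by simp
  qed
  have "(\<lambda>L. h L x) \<longlonglongrightarrow> (\<Sum>n\<in>?N. of_real 1 * fourier_coeff f n * character n x)" for x
    unfolding h_def by (intro tendsto_intros fejer_multiplier_tendsto)
  then have lim: "(\<lambda>L. ennreal (cmod (h L x) ^ ?p)) \<longlonglongrightarrow> ennreal (cmod (partial_sum M f x) ^ ?p)" for x
    by (intro tendsto_ennrealI tendsto_intros) (simp add: partial_sum_eq)
  note [measurable] = Lp_bounded_measurable[OF h] partial_sum_measurable
  have "(\<integral>\<^sup>+x. ennreal (cmod (partial_sum M f x) ^ ?p) \<partial>torus) = (\<integral>\<^sup>+x. liminf (\<lambda>L. ennreal (cmod (h L x) ^ ?p)) \<partial>torus)"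
    by (intro nn_integral_cong lim_imp_Liminf[symmetric] lim) simp
  also have "\<dots> \<le> liminf (\<lambda>L. \<integral>\<^sup>+x. ennreal (cmod (h L x) ^ ?p) \<partial>torus)"
    by (rule nn_integral_liminf) measurable
  also have "\<dots> \<le> ennreal (?C ^ ?p)"
    by (rule Liminf_le[OF sequentially_bot]) (intro always_eventually allI Lp_bounded_D[OF h])
  finally show ?thesis by (simp add: Lp_bounded_def partial_sum_measurable)
qed

section \<open>Interpolation of modulars between two exponents\<close>

text \<open>
  For \<open>a \<le> b\<close> this is \<open>r\<^sup>b\<close> below \<open>r = 1\<close> and \<open>r\<^sup>a\<close> above. It is the modular that belongs to cutting a function
  at a height: with \<open>r = \<bar>f\<bar> / l\<close> the low part of \<open>f\<close> is measured in \<open>L\<^sup>b\<close> and the high part in \<open>L\<^sup>a\<close>.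
\<close>

definition mixed_power :: "nat \<Rightarrow> nat \<Rightarrow> real \<Rightarrow> real" where
  "mixed_power a b r = min (r ^ a) (r ^ b)"

lemma mixed_power_measurable [measurable]: "mixed_power a b \<in> borel_measurable borel"
  unfolding mixed_power_def by measurable

lemma mixed_power_nonneg: "0 \<le> r \<Longrightarrow> 0 \<le> mixed_power a b r"
  by (simp add: mixed_power_def)

lemma mixed_power_mono: "0 \<le> r \<Longrightarrow> r \<le> s \<Longrightarrow> mixed_power a b r \<le> mixed_power a b s"
  unfolding mixed_power_def by (intro min.mono power_mono)

lemma mixed_power_le_1:
  assumes "0 \<le> r" "r \<le> 1" "a \<le> b" shows "mixed_power a b r = r ^ b"
  using power_decreasing[of a b r] assms by (simp add: mixed_power_def)

lemma mixed_power_ge_1: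
  assumes "1 \<le> r" "a \<le> b" shows "mixed_power a b r = r ^ a"
  using power_increasing[of a b r] assms by (simp add: mixed_power_def)

text \<open>
  Operators are considered on integrable functions, where the Fourier coefficients are additive; the
  integrals of the \<open>p\<close>-th powers may be infinite.
\<close>

definition strong_type :: "'a measure \<Rightarrow> (('a \<Rightarrow> complex) \<Rightarrow> 'a \<Rightarrow> complex) \<Rightarrow> nat \<Rightarrow> real \<Rightarrow> bool" where
  "strong_type M T p A \<longleftrightarrow> (\<forall>g. integrable M g \<longrightarrow> T g \<in> borel_measurable M \<and>
     (\<integral>\<^sup>+x. ennreal (cmod (T g x) ^ p) \<partial>M) \<le> ennreal (A ^ p) * (\<integral>\<^sup>+x. ennreal (cmod (g x) ^ p) \<partial>M))"

definition subadditive_on_L1 :: "'a measure \<Rightarrow> (('a \<Rightarrow> complex) \<Rightarrow> 'a \<Rightarrow> complex) \<Rightarrow> bool" where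
  "subadditive_on_L1 M T \<longleftrightarrow> (\<forall>g h x. integrable M g \<longrightarrow> integrable M h \<longrightarrow>
     cmod (T (\<lambda>y. g y + h y) x) \<le> cmod (T g x) + cmod (T h x))"

lemma strong_type_scaled:
  assumes T: "strong_type M T p A" and A: "A > 0" and l: "l > 0" and g: "integrable M g"
  shows "(\<integral>\<^sup>+x. ennreal ((cmod (T g x) / (A * l)) ^ p) \<partial>M) \<le> (\<integral>\<^sup>+x. ennreal ((cmod (g x) / l) ^ p) \<partial>M)"
proof -
  note [measurable] = borel_measurable_integrable[OF g]
  have [measurable]: "T g \<in> borel_measurable M" using T g by (simp add: strong_type_def)
  have "(\<integral>\<^sup>+x. ennreal ((cmod (T g x) / (A * l)) ^ p) \<partial>M)
      = (\<integral>\<^sup>+x. ennreal (1 / (A * l) ^ p) * ennreal (cmod (T g x) ^ p) \<partial>M)"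
    using A l by (simp add: power_divide flip: ennreal_mult')
  also have "\<dots> = ennreal (1 / (A * l) ^ p) * (\<integral>\<^sup>+x. ennreal (cmod (T g x) ^ p) \<partial>M)"
    by (rule nn_integral_cmult) measurable
  also have "\<dots> \<le> ennreal (1 / (A * l) ^ p) * (ennreal (A ^ p) * (\<integral>\<^sup>+x. ennreal (cmod (g x) ^ p) \<partial>M))"
    using T g by (intro mult_left_mono) (auto simp: strong_type_def)
  also have "\<dots> = ennreal (1 / l ^ p) * (\<integral>\<^sup>+x. ennreal (cmod (g x) ^ p) \<partial>M)"
    using A l by (simp add: power_mult_distrib flip: mult.assoc ennreal_mult')
  also have "\<dots> = (\<integral>\<^sup>+x. ennreal (1 / l ^ p) * ennreal (cmod (g x) ^ p) \<partial>M)"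
    by (rule nn_integral_cmult[symmetric]) measurable
  also have "\<dots> = (\<integral>\<^sup>+x. ennreal ((cmod (g x) / l) ^ p) \<partial>M)"
    using l by (simp add: power_divide flip: ennreal_mult')
  finally show ?thesis .
qed

text \<open>
  The elementary step of Marcinkiewicz interpolation at one height \<open>l\<close>. The cut \<open>f = g + h\<close> at \<open>l\<close> loses nothing on the
  right-hand side, and on the left the larger of \<open>\<bar>T g\<bar>\<close> and \<open>\<bar>T h\<bar>\<close> controls \<open>\<bar>T f\<bar> / 2\<close> and may be measured by
  either of the two powers. Because \<open>A\<close> divides inside the modular, the constant of the inequality is \<open>1\<close>, even though
  the exponents will tend to infinity.
\<close>

lemma nn_integral_mixed_power_le:
  assumes sub: "subadditive_on_L1 M T"
    and Ta: "strong_type M T a A" and Tb: "strong_type M T b A"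
    and ab: "0 < a" "a \<le> b" and A: "A > 0" and l: "l > 0" and f: "integrable M f"
  shows "(\<integral>\<^sup>+x. ennreal (mixed_power a b (cmod (T f x) / (2 * A) / l)) \<partial>M)
    \<le> (\<integral>\<^sup>+x. ennreal (mixed_power a b (cmod (f x) / l)) \<partial>M)"
proof -
  note [measurable] = borel_measurable_integrable[OF f]
  define g h where "g = (\<lambda>x. if cmod (f x) \<le> l then f x else 0)"
    and "h = (\<lambda>x. if cmod (f x) \<le> l then 0 else f x)"
  have [measurable]: "g \<in> borel_measurable M" "h \<in> borel_measurable M"
    unfolding g_def h_def by measurable
  have g: "integrable M g" and h: "integrable M h"
    by (auto intro!: Bochner_Integration.integrable_bound[OF f] simp: g_def h_def)
  have gh: "f = (\<lambda>x. g x + h x)" by (auto simp: g_def h_def)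
  have [measurable]: "T g \<in> borel_measurable M" "T h \<in> borel_measurable M"
    using Ta g h by (auto simp: strong_type_def)
  have "mixed_power a b (cmod (T f x) / (2 * A) / l)
      \<le> (cmod (T g x) / (A * l)) ^ b + (cmod (T h x) / (A * l)) ^ a" for x
  proof -
    have "cmod (T f x) \<le> cmod (T g x) + cmod (T h x)"
      using sub g h unfolding subadditive_on_L1_def gh by blast
    also have "\<dots> \<le> 2 * max (cmod (T g x)) (cmod (T h x))" by simp
    finally have "cmod (T f x) / (2 * A) / l \<le> max (cmod (T g x)) (cmod (T h x)) / (A * l)"
      using A l by (simp add: field_simps)
    then have "mixed_power a b (cmod (T f x) / (2 * A) / l) \<le> mixed_power a b (max (cmod (T g x)) (cmod (T h x)) / (A * l))"
      using A l by (intro mixed_power_mono) auto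
    also have "\<dots> \<le> (cmod (T g x) / (A * l)) ^ b + (cmod (T h x) / (A * l)) ^ a"
      using A l by (auto simp: mixed_power_def max_def add_increasing add_increasing2 min.coboundedI1 min.coboundedI2)
    finally show ?thesis .
  qed
  then have "(\<integral>\<^sup>+x. ennreal (mixed_power a b (cmod (T f x) / (2 * A) / l)) \<partial>M)
      \<le> (\<integral>\<^sup>+x. ennreal ((cmod (T g x) / (A * l)) ^ b) + ennreal ((cmod (T h x) / (A * l)) ^ a) \<partial>M)"
    using A l by (intro nn_integral_mono) (simp flip: ennreal_plus)
  also have "\<dots> = (\<integral>\<^sup>+x. ennreal ((cmod (T g x) / (A * l)) ^ b) \<partial>M) + (\<integral>\<^sup>+x. ennreal ((cmod (T h x) / (A * l)) ^ a) \<partial>M)"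
    by (rule nn_integral_add) measurable
  also have "\<dots> \<le> (\<integral>\<^sup>+x. ennreal ((cmod (g x) / l) ^ b) \<partial>M) + (\<integral>\<^sup>+x. ennreal ((cmod (h x) / l) ^ a) \<partial>M)"
    by (intro add_mono strong_type_scaled Ta Tb A l g h)
  also have "\<dots> = (\<integral>\<^sup>+x. ennreal ((cmod (g x) / l) ^ b) + ennreal ((cmod (h x) / l) ^ a) \<partial>M)"
    by (rule nn_integral_add[symmetric]) measurable
  also have "\<dots> = (\<integral>\<^sup>+x. ennreal (mixed_power a b (cmod (f x) / l)) \<partial>M)"
    using l ab by (intro nn_integral_cong) (auto simp: g_def h_def mixed_power_le_1 mixed_power_ge_1 power_0_left)
  finally show ?thesis .
qed

text \<open>
  A function of \<open>u\<close> that grows at rates strictly between \<open>u\<^sup>a\<close> and \<open>u\<^sup>b\<close> is comparable, for \<open>u \<ge> 1\<close>, with this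
  superposition of mixed powers at the heights \<open>2\<^sup>j\<close>, and the superposition inherits the interpolation
  inequality of each height.
\<close>

definition dyadic_majorant :: "nat \<Rightarrow> nat \<Rightarrow> (real \<Rightarrow> ennreal) \<Rightarrow> real \<Rightarrow> ennreal" where
  "dyadic_majorant a b F u = (\<Sum>j. F (2 ^ j) * ennreal (mixed_power a b (u / 2 ^ j)))"

lemma dyadic_majorant_measurable [measurable]: "dyadic_majorant a b F \<in> borel_measurable borel"
  unfolding dyadic_majorant_def by measurable

lemma nn_integral_dyadic_majorant_le:
  assumes sub: "subadditive_on_L1 M T"
    and Ta: "strong_type M T a A" and Tb: "strong_type M T b A"
    and ab: "0 < a" "a \<le> b" and A: "A > 0" and f: "integrable M f"
  shows "(\<integral>\<^sup>+x. dyadic_majorant a b F (cmod (T f x) / (2 * A)) \<partial>M) \<le> (\<integral>\<^sup>+x. dyadic_majorant a b F (cmod (f x)) \<partial>M)"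
proof -
  note [measurable] = borel_measurable_integrable[OF f]
  have [measurable]: "T f \<in> borel_measurable M"
    using Ta f by (auto simp: strong_type_def)
  have *: "(\<integral>\<^sup>+x. dyadic_majorant a b F (v x) \<partial>M) = (\<Sum>j. F (2 ^ j) * (\<integral>\<^sup>+x. ennreal (mixed_power a b (v x / 2 ^ j)) \<partial>M))"
    if [measurable]: "v \<in> borel_measurable M" for v
    unfolding dyadic_majorant_def by (subst nn_integral_suminf) (auto simp: nn_integral_cmult)
  show ?thesis
    by (subst (1 2) *, measurable, measurable)
      (intro suminf_le summableI mult_left_mono nn_integral_mixed_power_le[OF sub Ta Tb ab A _ f], auto)
qed

text \<open>
  The sum over both flanks of a peak at \<open>2\<^sup>j \<approx> u\<close>. The bound is stated in a form that survives the
  induction step, which replaces \<open>u\<close> by \<open>u / 2\<close>; the part \<open>- 2 / u\<close> absorbs the new summand \<open>1 / u\<close>.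
\<close>

lemma sum_min_dyadic_le:
  fixes u :: real
  assumes "u > 0"
  shows "(\<Sum>j<n. min (2 ^ j / u) (u / 2 ^ j)) \<le> (if u \<le> 1 then 2 * u else 4 - 2 / u)"
  using assms
proof (induction n arbitrary: u)
  case 0
  then show ?case by (auto simp: field_simps)
next
  case (Suc n)
  have "(\<Sum>j<Suc n. min (2 ^ j / u) (u / 2 ^ j))
      = min (1 / u) u + (\<Sum>j<n. min (2 ^ j / (u / 2)) (u / 2 / 2 ^ j))"
    unfolding sum.lessThan_Suc_shift by (simp add: ac_simps)
  also have "\<dots> \<le> min (1 / u) u + (if u / 2 \<le> 1 then 2 * (u / 2) else 4 - 2 / (u / 2))"
    using Suc.prems by (intro add_left_mono Suc.IH) auto
  also have "\<dots> \<le> (if u \<le> 1 then 2 * u else 4 - 2 / u)"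
  proof -
    consider "u \<le> 1" | "1 < u" "u \<le> 2" | "2 < u" by linarith
    then show ?thesis
    proof cases
      case 2
      then have "(u - 1) * (u - 3) \<le> 0" by (intro mult_nonneg_nonpos) auto
      then have "(u - 1) * (u - 3) / u \<le> 0" using 2 by (intro divide_nonpos_pos) auto
      moreover have "1 / u + u - (4 - 2 / u) = (u - 1) * (u - 3) / u"
        using 2 by (simp add: field_simps)
      ultimately have "1 / u + u \<le> 4 - 2 / u" by linarith
      then show ?thesis using 2 by auto
    qed (use Suc.prems in \<open>auto simp: field_simps min_def\<close>)
  qed
  finally show ?case .
qed

lemma suminf_min_dyadic_le:
  fixes u :: real
  assumes "u > 0"
  shows "(\<Sum>j. ennreal (min (2 ^ j / u) (u / 2 ^ j))) \<le> 4"
proof (rule suminf_le_const)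
  fix n
  have "(\<Sum>j<n. ennreal (min (2 ^ j / u) (u / 2 ^ j))) = ennreal (\<Sum>j<n. min (2 ^ j / u) (u / 2 ^ j))"
    using assms by (intro sum_ennreal) auto
  also have "\<dots> \<le> ennreal 4"
    using sum_min_dyadic_le[OF assms, of n] assms
    by (intro ennreal_leI) (auto split: if_splits elim!: order_trans)
  finally show "(\<Sum>j<n. ennreal (min (2 ^ j / u) (u / 2 ^ j))) \<le> 4" by simp
qed simp

lemma dyadic_interval:
  fixes u :: real
  assumes "1 \<le> u"
  obtains j :: nat where "2 ^ j \<le> u" "u < 2 * 2 ^ j"
proof -
  define n where "n = nat \<lfloor>u\<rfloor>"
  have n: "n \<ge> 1" "real n \<le> u" "u < real n + 1"
    using assms by (auto simp: n_def le_nat_iff)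
  obtain j where j: "2 ^ j \<le> n" "n < 2 ^ (j + 1)"
    using ex_power_ivl1[of 2 n] n(1) by auto
  have "real (2 ^ j) \<le> real n" "real (n + 1) \<le> real (2 ^ (j + 1))"
    using j by (simp_all only: of_nat_le_iff)
  then have "real (2 ^ j) \<le> u" "u < real (2 ^ (j + 1))" using n by linarith+
  then show ?thesis by (intro that[of j]) simp_all
qed

text \<open>
  The summand whose height \<open>2\<^sup>j\<close> is within a factor two below \<open>u\<close> alone suffices. Heights below \<open>1\<close> are absent
  from the sum, and \<open>F 1\<close> takes their place.
\<close>

lemma dyadic_majorant_ge:
  assumes F: "\<And>t u. 0 \<le> t \<Longrightarrow> 0 \<le> u \<Longrightarrow> F (t * u) \<le> ennreal (max (t ^ q) (t ^ (2 * q))) * F u"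
    and u: "0 \<le> u"
  shows "F u \<le> F 1 + ennreal (4 ^ q) * dyadic_majorant a b F u"
proof (cases "u \<le> 1")
  case True
  then have "max (u ^ q) (u ^ (2 * q)) \<le> 1" using u by (auto intro!: power_le_one)
  then have "ennreal (max (u ^ q) (u ^ (2 * q))) * F 1 \<le> 1 * F 1"
    by (intro mult_right_mono) (auto simp: ennreal_le_1)
  moreover have "F u \<le> ennreal (max (u ^ q) (u ^ (2 * q))) * F 1" using F[of u 1] u by simp
  ultimately have "F u \<le> F 1" by simp
  then show ?thesis by (rule add_increasing2[rotated]) simp
next
  case False
  obtain j :: nat where "2 ^ j \<le> u" "u < 2 * 2 ^ j"
    using dyadic_interval[of u] False by auto
  then have t: "1 \<le> u / 2 ^ j" "u / 2 ^ j \<le> 2" by (auto simp: field_simps)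
  have "(u / 2 ^ j) ^ q \<le> (u / 2 ^ j) ^ (2 * q)" using t by (intro power_increasing) auto
  moreover have "(u / 2 ^ j) ^ (2 * q) \<le> 2 ^ (2 * q)" by (intro power_mono t(2) order_trans[OF zero_le_one t(1)])
  ultimately have "max ((u / 2 ^ j) ^ q) ((u / 2 ^ j) ^ (2 * q)) \<le> 4 ^ q"
    by (simp add: power_mult)
  then have "ennreal (max ((u / 2 ^ j) ^ q) ((u / 2 ^ j) ^ (2 * q))) * F (2 ^ j) \<le> ennreal (4 ^ q) * F (2 ^ j)"
    by (intro mult_right_mono ennreal_leI) auto
  moreover have "F u \<le> ennreal (max ((u / 2 ^ j) ^ q) ((u / 2 ^ j) ^ (2 * q))) * F (2 ^ j)"
    using F[of "u / 2 ^ j" "2 ^ j"] u by simp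
  ultimately have "F u \<le> ennreal (4 ^ q) * F (2 ^ j)" by (rule order_trans[rotated])
  moreover have "F (2 ^ j) \<le> dyadic_majorant a b F u"
  proof -
    have "1 \<le> mixed_power a b (u / 2 ^ j)"
      using t by (auto simp: mixed_power_def intro!: one_le_power simp del: le_divide_eq_1_pos)
    then have "F (2 ^ j) * 1 \<le> F (2 ^ j) * ennreal (mixed_power a b (u / 2 ^ j))"
      by (intro mult_left_mono) (simp_all add: ennreal_ge_1)
    also have "\<dots> \<le> dyadic_majorant a b F u"
      unfolding dyadic_majorant_def
      using sum_le_suminf[of "\<lambda>j. F (2 ^ j) * ennreal (mixed_power a b (u / 2 ^ j))" "{j}"] by simp
    finally show ?thesis by simp
  qed
  then have "ennreal (4 ^ q) * F (2 ^ j) \<le> ennreal (4 ^ q) * dyadic_majorant a b F u"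
    by (rule mult_left_mono) simp
  ultimately have "F u \<le> ennreal (4 ^ q) * dyadic_majorant a b F u" by (rule order_trans)
  then show ?thesis by (rule add_increasing[rotated]) simp
qed

text \<open>
  Away from \<open>u\<close> the mixed power decays faster than \<open>F\<close> can grow in the other direction: the gaps \<open>a < q\<close> and
  \<open>2 q < b\<close> leave at least one power of \<open>2\<^sup>j / u\<close> or its inverse, so the sum over \<open>j\<close> is bounded independently
  of the exponents.
\<close>

lemma dyadic_majorant_le:
  assumes F: "\<And>t u. 0 \<le> t \<Longrightarrow> 0 \<le> u \<Longrightarrow> F (t * u) \<le> ennreal (max (t ^ q) (t ^ (2 * q))) * F u"
    and ab: "0 < a" "a < q" "2 * q < b" and u: "0 \<le> u"
  shows "dyadic_majorant a b F u \<le> 4 * F u"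
proof (cases "u = 0")
  case True
  then show ?thesis using ab by (simp add: dyadic_majorant_def mixed_power_def power_0_left)
next
  case False
  with u have u: "u > 0" by simp
  have "F (2 ^ j) * ennreal (mixed_power a b (u / 2 ^ j)) \<le> F u * ennreal (min (2 ^ j / u) (u / 2 ^ j))" for j
  proof -
    define t where "t = 2 ^ j / u"
    have t: "t > 0" "u / 2 ^ j = 1 / t" using u by (auto simp: t_def)
    have "max (t ^ q) (t ^ (2 * q)) * mixed_power a b (1 / t) \<le> min t (1 / t)"
    proof (cases "t \<le> 1")
      case True
      have "t ^ (2 * q) \<le> t ^ q" using True t by (intro power_decreasing) auto
      moreover have "1 \<le> 1 / t" using True t by simp
      then have "mixed_power a b (1 / t) = (1 / t) ^ a" using ab by (intro mixed_power_ge_1) auto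
      moreover have "t ^ q * (1 / t) ^ a = t ^ (q - a)" using ab t by (simp add: power_diff power_one_over field_simps)
      moreover have "t ^ (q - a) \<le> t ^ 1" using ab True t by (intro power_decreasing) auto
      moreover have "t \<le> 1 / t" using True \<open>1 \<le> 1 / t\<close> by linarith
      ultimately show ?thesis by simp
    next
      case False
      have "t ^ q \<le> t ^ (2 * q)" using False by (intro power_increasing) auto
      moreover have 1: "1 / t \<le> 1" using False t by simp
      then have "mixed_power a b (1 / t) = (1 / t) ^ b" using ab t by (intro mixed_power_le_1) auto
      moreover have "t ^ (2 * q) * (1 / t) ^ b = (1 / t) ^ (b - 2 * q)"
        using ab t by (simp add: power_diff power_one_over field_simps)
      moreover have "(1 / t) ^ (b - 2 * q) \<le> (1 / t) ^ 1" using ab 1 t by (intro power_decreasing) auto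
      moreover have "1 / t \<le> t" using 1 False by linarith
      ultimately show ?thesis by simp
    qed
    then have "ennreal (max (t ^ q) (t ^ (2 * q)) * mixed_power a b (1 / t)) \<le> ennreal (min t (1 / t))"
      by (rule ennreal_leI)
    moreover have "ennreal (max (t ^ q) (t ^ (2 * q)) * mixed_power a b (1 / t))
        = ennreal (max (t ^ q) (t ^ (2 * q))) * ennreal (mixed_power a b (1 / t))"
      using t by (intro ennreal_mult) (auto simp: mixed_power_nonneg le_max_iff_disj)
    ultimately have "ennreal (max (t ^ q) (t ^ (2 * q))) * ennreal (mixed_power a b (1 / t)) \<le> ennreal (min t (1 / t))"
      by simp
    then have "ennreal (max (t ^ q) (t ^ (2 * q))) * ennreal (mixed_power a b (1 / t)) * F u \<le> ennreal (min t (1 / t)) * F u"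
      by (rule mult_right_mono) simp
    moreover have "F (2 ^ j) \<le> ennreal (max (t ^ q) (t ^ (2 * q))) * F u"
      using F[of t u] t u by (simp add: t_def)
    then have "F (2 ^ j) * ennreal (mixed_power a b (1 / t)) \<le> ennreal (max (t ^ q) (t ^ (2 * q))) * F u * ennreal (mixed_power a b (1 / t))"
      by (rule mult_right_mono) simp
    ultimately have "F (2 ^ j) * ennreal (mixed_power a b (1 / t)) \<le> F u * ennreal (min t (1 / t))"
      by (simp only: mult.assoc mult.commute mult.left_commute)
    then show ?thesis unfolding t(2) t_def[symmetric] .
  qed
  then have "dyadic_majorant a b F u \<le> (\<Sum>j. F u * ennreal (min (2 ^ j / u) (u / 2 ^ j)))"
    unfolding dyadic_majorant_def by (intro suminf_le summableI) auto
  also have "\<dots> = F u * (\<Sum>j. ennreal (min (2 ^ j / u) (u / 2 ^ j)))" by simp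
  also have "\<dots> \<le> F u * 4" by (intro mult_left_mono suminf_min_dyadic_le u) simp
  finally show ?thesis by (simp add: mult.commute)
qed

section \<open>Young functions and windows of exponents\<close>

text \<open>
  The common properties of \<open>\<psi>\<close> and \<open>\<psi>\<^sub>d\<close> that make the supremum in the definition of the Young function
  finite. They pass from \<open>\<psi>\<close> to \<open>\<psi>\<^sub>d\<close> because \<open>p\<^sup>d\<close> is increasing and at least \<open>1\<close>.
\<close>

definition increasing_weight :: "real \<Rightarrow> (real \<Rightarrow> real) \<Rightarrow> bool" where
  "increasing_weight \<alpha> \<rho> \<longleftrightarrow> (\<forall>p\<ge>\<alpha>. 0 < \<rho> p) \<and> (\<forall>p\<ge>\<alpha>. \<forall>q\<ge>p. \<rho> p \<le> \<rho> q) \<and> filterlim \<rho> at_top at_top"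

lemma increasing_weight_Psi:
  assumes "\<psi> \<in> Psi_class \<alpha>" shows "increasing_weight \<alpha> \<psi>"
proof -
  have "mono_on {\<alpha>..} \<psi>"
    using assms by (auto simp: Psi_class_def intro: strict_mono_on_imp_mono_on)
  then show ?thesis
    using assms by (auto simp: Psi_class_def increasing_weight_def mono_on_def)
qed

lemma increasing_weight_psi_pow:
  assumes "increasing_weight \<alpha> \<rho>" "\<alpha> \<ge> 1"
  shows "increasing_weight \<alpha> (psi_pow d \<rho>)"
proof -
  have ge: "\<rho> p \<le> psi_pow d \<rho> p" if "p \<ge> \<alpha>" for p
  proof -
    have "1 * \<rho> p \<le> p ^ d * \<rho> p"
      using assms that by (intro mult_right_mono one_le_power) (auto simp: increasing_weight_def intro: less_imp_le)
    then show ?thesis by (simp add: psi_pow_def)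
  qed
  have "filterlim (psi_pow d \<rho>) at_top at_top"
  proof (rule filterlim_at_top_mono)
    show "filterlim \<rho> at_top at_top" using assms by (simp add: increasing_weight_def)
    show "\<forall>\<^sub>F p in at_top. \<rho> p \<le> psi_pow d \<rho> p"
      using eventually_ge_at_top[of \<alpha>] by eventually_elim (rule ge)
  qed
  moreover have "psi_pow d \<rho> p \<le> psi_pow d \<rho> q" if "p \<ge> \<alpha>" "q \<ge> p" for p q
    unfolding psi_pow_def using assms that
    by (intro mult_mono power_mono) (auto simp: increasing_weight_def intro: less_imp_le)
  moreover have "0 < psi_pow d \<rho> p" if "p \<ge> \<alpha>" for p
    using assms that by (auto simp: increasing_weight_def psi_pow_def)
  ultimately show ?thesis by (simp add: increasing_weight_def)
qed

text \<open>
  Once \<open>\<rho> p\<close> exceeds \<open>u\<close> the exponent is negative; before that \<open>p\<close> ranges over a bounded interval.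
\<close>

lemma bdd_above_young_exponent:
  assumes \<rho>: "increasing_weight \<alpha> \<rho>" and \<alpha>: "\<alpha> \<ge> 1" and u: "u > 0"
  shows "bdd_above ((\<lambda>p. p * ln u - p * ln (\<rho> p)) ` {\<alpha>..})"
proof -
  have "\<forall>\<^sub>F p in at_top. u \<le> \<rho> p"
    using \<rho> by (auto simp: increasing_weight_def filterlim_at_top)
  then obtain P where P: "\<And>p. p \<ge> P \<Longrightarrow> u \<le> \<rho> p"
    by (auto simp: eventually_at_top_linorder)
  define Q where "Q = max P \<alpha>"
  have "p * ln u - p * ln (\<rho> p) \<le> Q * \<bar>ln u - ln (\<rho> \<alpha>)\<bar>" if p: "p \<ge> \<alpha>" for p
  proof (cases "p \<ge> P")
    case True
    then have "ln u \<le> ln (\<rho> p)" by (subst ln_le_cancel_iff) (use P[OF True] u in auto)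
    then have "p * ln u - p * ln (\<rho> p) \<le> 0" using p \<alpha> by (simp add: mult_left_mono)
    also have "0 \<le> Q * \<bar>ln u - ln (\<rho> \<alpha>)\<bar>" using \<alpha> by (simp add: Q_def)
    finally show ?thesis .
  next
    case False
    have "ln (\<rho> \<alpha>) \<le> ln (\<rho> p)" using \<rho> p by (auto simp: increasing_weight_def)
    then have "p * (ln u - ln (\<rho> p)) \<le> p * \<bar>ln u - ln (\<rho> \<alpha>)\<bar>"
      using p \<alpha> by (intro mult_left_mono) auto
    also have "\<dots> \<le> Q * \<bar>ln u - ln (\<rho> \<alpha>)\<bar>"
      using False by (intro mult_right_mono) (auto simp: Q_def)
    finally show ?thesis by (simp add: algebra_simps)
  qed
  then show ?thesis by (auto intro!: bdd_aboveI)
qed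

lemma exp_young_exponent:
  fixes p :: real
  assumes "u > 0" "c > 0"
  shows "exp (p * ln u - p * ln c) = (u / c) powr p"
  using assms by (simp add: powr_def ln_div right_diff_distrib)

lemma young_version_ge:
  assumes \<rho>: "increasing_weight \<alpha> \<rho>" and \<alpha>: "\<alpha> \<ge> 1" and N: "N \<in> young_versions \<alpha> \<rho>"
    and u: "exp 2 \<le> u" and p: "\<alpha> \<le> p"
  shows "(u / \<rho> p) powr p \<le> N u"
proof -
  have u0: "u > 0" using u exp_gt_zero[of "2::real"] by linarith
  have "(u / \<rho> p) powr p = exp (p * ln u - p * ln (\<rho> p))"
    using \<rho> p u0 by (subst exp_young_exponent) (auto simp: increasing_weight_def)
  also have "\<dots> \<le> exp (SUP p\<in>{\<alpha>..}. p * ln u - p * ln (\<rho> p))"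
    using p by (subst exp_le_cancel_iff, intro cSUP_upper bdd_above_young_exponent[OF \<rho> \<alpha> u0]) auto
  also have "\<dots> = N u" using N u u0 by (simp add: young_versions_def)
  finally show ?thesis .
qed

text \<open>
  Stated for extended bounds, because the majorant used below is a series of extended reals.
\<close>

lemma young_version_le:
  assumes \<rho>: "increasing_weight \<alpha> \<rho>" and N: "N \<in> young_versions \<alpha> \<rho>"
    and u: "exp 2 \<le> u" and B: "\<And>p. \<alpha> \<le> p \<Longrightarrow> ennreal ((u / \<rho> p) powr p) \<le> B"
  shows "ennreal (N u) \<le> B"
proof (cases B)
  case (real b)
  have u0: "u > 0" using u exp_gt_zero[of "2::real"] by linarith
  have b: "(u / \<rho> p) powr p \<le> b" if "\<alpha> \<le> p" for p
    using B[OF that] real by simp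
  have "0 < (u / \<rho> \<alpha>) powr \<alpha>" using u0 \<rho> by (auto simp: increasing_weight_def)
  with b[of \<alpha>] have b0: "b > 0" by linarith
  have "N u = exp (SUP p\<in>{\<alpha>..}. p * ln u - p * ln (\<rho> p))"
    using N u u0 by (simp add: young_versions_def)
  also have "(SUP p\<in>{\<alpha>..}. p * ln u - p * ln (\<rho> p)) \<le> ln b"
  proof (rule cSUP_least)
    fix p assume "p \<in> {\<alpha>..}"
    then have "exp (p * ln u - p * ln (\<rho> p)) \<le> exp (ln b)"
      using b[of p] b0 u0 \<rho> by (subst exp_young_exponent) (auto simp: increasing_weight_def)
    then show "p * ln u - p * ln (\<rho> p) \<le> ln b" by simp
  qed auto
  then have "exp (SUP p\<in>{\<alpha>..}. p * ln u - p * ln (\<rho> p)) \<le> exp (ln b)" by simp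
  finally show ?thesis using real b0 by (simp add: ennreal_leI)
qed simp

lemma young_version_mono:
  assumes "N \<in> young_versions \<alpha> \<rho>" "0 \<le> u" "u \<le> v" shows "N u \<le> N v"
  using assms by (auto simp: young_versions_def strict_mono_on_leD)

lemma young_version_nonneg:
  assumes "N \<in> young_versions \<alpha> \<rho>" "0 \<le> u" shows "0 \<le> N u"
proof -
  have "N 0 = 0" using assms(1) by (auto simp: young_versions_def)
  then show ?thesis using young_version_mono[OF assms(1) order_refl assms(2)] by simp
qed

lemma young_version_measurable:
  assumes "N \<in> young_versions \<alpha> \<rho>" shows "N \<in> borel_measurable borel"
  using assms by (intro borel_measurable_continuous_onI) (simp add: young_versions_def)

lemma young_version_scale:
  assumes N: "N \<in> young_versions \<alpha> \<rho>" and t: "0 \<le> t" "t \<le> 1"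
  shows "N (t * u) \<le> t * N u"
proof -
  have "convex_on UNIV N" "N 0 = 0" using N by (auto simp: young_versions_def)
  then show ?thesis using convex_onD[of UNIV N t 0 u] t by simp
qed

text \<open>
  The value at \<open>e\<^sup>2\<close> that all versions of the Young function share. As the versions are arbitrary on \<open>[0, e\<^sup>2)\<close>,
  their smaller values are always estimated by it, and the constants become independent of the version.
\<close>

definition young_at_exp2 :: "real \<Rightarrow> (real \<Rightarrow> real) \<Rightarrow> real" where
  "young_at_exp2 \<alpha> \<rho> = exp (SUP p\<in>{\<alpha>..}. p * 2 - p * ln (\<rho> p))"

lemma young_version_exp2:
  assumes "N \<in> young_versions \<alpha> \<rho>" shows "N (exp 2) = young_at_exp2 \<alpha> \<rho>"
  using assms by (simp add: young_versions_def young_at_exp2_def)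

text \<open>
  The contribution of the exponents \<open>q \<le> p \<le> 2 q\<close> to the Young function; the extended reals make the supremum
  unconditional. Its growth lies between \<open>u\<^sup>q\<close> and \<open>u\<^bsup>2 q\<^esup>\<close>, which is what interpolation needs, whereas
  the full supremum has no bounded growth exponent.
\<close>

definition window_sup :: "(real \<Rightarrow> real) \<Rightarrow> nat \<Rightarrow> real \<Rightarrow> ennreal" where
  "window_sup \<rho> q u = (SUP p\<in>{real q..2 * real q}. ennreal ((u / \<rho> p) powr p))"

lemma powr_le_max_power:
  fixes t p :: real
  assumes "0 \<le> t" "real q \<le> p" "p \<le> 2 * real q" "0 < q"
  shows "t powr p \<le> max (t ^ q) (t ^ (2 * q))"
proof (cases "t = 0")
  case False
  with assms have t: "t > 0" by simp
  show ?thesis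
  proof (cases "t \<le> 1")
    case True
    then have "t powr p \<le> t powr real q" using assms t by (intro powr_mono') auto
    then show ?thesis using t by (simp add: powr_realpow le_max_iff_disj)
  next
    case False
    then have "t powr p \<le> t powr real (2 * q)" using assms by (intro powr_mono) auto
    then show ?thesis using t by (simp only: powr_realpow le_max_iff_disj) simp
  qed
qed (use assms in \<open>auto simp: le_max_iff_disj\<close>)

lemma window_sup_scale:
  assumes \<rho>: "increasing_weight \<alpha> \<rho>" and q: "\<alpha> \<le> real q" "0 < q" and tu: "0 \<le> t" "0 \<le> u"
  shows "window_sup \<rho> q (t * u) \<le> ennreal (max (t ^ q) (t ^ (2 * q))) * window_sup \<rho> q u"
  unfolding window_sup_def
proof (rule SUP_least)
  fix p assume p: "p \<in> {real q..2 * real q}"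
  then have "0 < \<rho> p" using \<rho> q by (auto simp: increasing_weight_def)
  then have "(t * u / \<rho> p) powr p = t powr p * (u / \<rho> p) powr p"
    using tu by (simp add: powr_mult flip: times_divide_eq_right)
  then have "ennreal ((t * u / \<rho> p) powr p) = ennreal (t powr p) * ennreal ((u / \<rho> p) powr p)"
    by (simp add: ennreal_mult)
  also have "\<dots> \<le> ennreal (max (t ^ q) (t ^ (2 * q))) * (SUP p\<in>{real q..2 * real q}. ennreal ((u / \<rho> p) powr p))"
    using p q tu by (intro mult_mono ennreal_leI powr_le_max_power SUP_upper) auto
  finally show "ennreal ((t * u / \<rho> p) powr p)
      \<le> ennreal (max (t ^ q) (t ^ (2 * q))) * (SUP p\<in>{real q..2 * real q}. ennreal ((u / \<rho> p) powr p))" .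
qed

lemma window_sup_le_young:
  assumes \<rho>: "increasing_weight \<alpha> \<rho>" and \<alpha>: "\<alpha> \<ge> 1" and N: "N \<in> young_versions \<alpha> \<rho>"
    and q: "\<alpha> \<le> real q" and u: "0 \<le> u"
  shows "window_sup \<rho> q u \<le> ennreal (N (max u (exp 2)))"
  unfolding window_sup_def
proof (rule SUP_least)
  fix p assume p: "p \<in> {real q..2 * real q}"
  then have "0 < \<rho> p" using \<rho> q by (auto simp: increasing_weight_def)
  then have "(u / \<rho> p) powr p \<le> (max u (exp 2) / \<rho> p) powr p"
    using u p q \<alpha> by (intro powr_mono2 divide_right_mono) auto
  also have "\<dots> \<le> N (max u (exp 2))"
    using p q by (intro young_version_ge[OF \<rho> \<alpha> N]) auto
  finally show "ennreal ((u / \<rho> p) powr p) \<le> ennreal (N (max u (exp 2)))" by (rule ennreal_leI)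
qed

lemma young_max_exp2_le:
  assumes N: "N \<in> young_versions \<alpha> \<rho>" and u: "0 \<le> u"
  shows "N (max u (exp 2)) \<le> young_at_exp2 \<alpha> \<rho> + N u"
  using young_version_nonneg[OF N u] young_version_nonneg[OF N, of "exp 2"] young_version_exp2[OF N]
  by (auto simp: max_def)

lemma young_at_exp2_pos: "0 < young_at_exp2 \<alpha> \<rho>"
  by (simp add: young_at_exp2_def)

text \<open>
  The supremum defining \<open>N\<^sub>d\<close> is distributed over the windows with \<open>q = 2\<^bsup>m0 + i\<^esup>\<close> and the exponents below
  \<open>P = 2\<^bsup>m0\<^esup>\<close>, which contribute at most a polynomial of degree \<open>P\<close>. In a window \<open>\<psi>\<^sub>d p \<ge> q\<^sup>d \<psi> p\<close>, so the
  extra \<open>p\<^sup>d\<close> in the weight pays for dividing by the operator bound \<open>(4 q)\<^sup>d\<close> at the exponent \<open>4 q\<close>. The choice of \<open>\<epsilon>\<close> leaves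
  a spare factor \<open>1 / 8\<close> inside the window supremum and hence \<open>(1 / 8)\<^sup>q\<close> outside, which will outweigh
  the \<open>4\<^sup>q\<close> of the dyadic majorant and make the sum over the windows converge.
\<close>

lemma psi_pow_young_version_le:
  fixes d m0 :: nat
  defines "\<epsilon> \<equiv> 1 / (16 * 4 ^ d)" and "q \<equiv> \<lambda>i. 2 ^ (m0 + i)" and "P \<equiv> 2 ^ m0"
  assumes \<psi>: "increasing_weight \<alpha> \<psi>" and \<alpha>: "\<alpha> \<ge> 1"
    and Nd: "Nd \<in> young_versions \<alpha> (psi_pow d \<psi>)" and m0: "\<alpha> \<le> 2 ^ m0" and u: "0 \<le> u"
  shows "ennreal (Nd (\<epsilon> * u)) \<le> ennreal (young_at_exp2 \<alpha> (psi_pow d \<psi>))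
      + (ennreal ((1 + u / psi_pow d \<psi> \<alpha>) ^ P)
      + (\<Sum>i. ennreal ((1 / 8) ^ q i) * (window_sup \<psi> (q i) 1 + ennreal (4 ^ q i) *
           dyadic_majorant (q i div 2) (4 * q i) (window_sup \<psi> (q i)) (u / (2 * (4 * real (q i)) ^ d)))))"
    (is "_ \<le> ?Y + (?L + (\<Sum>i. ?S i))")
proof (cases "exp 2 \<le> \<epsilon> * u")
  case False
  have "Nd (\<epsilon> * u) \<le> Nd (exp 2)"
    using False u by (intro young_version_mono[OF Nd]) (auto simp: \<epsilon>_def)
  then have "ennreal (Nd (\<epsilon> * u)) \<le> ?Y"
    unfolding young_version_exp2[OF Nd] by (rule ennreal_leI)
  then show ?thesis by (rule add_increasing2[rotated]) simp
next
  case True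
  have \<psi>d: "increasing_weight \<alpha> (psi_pow d \<psi>)" by (rule increasing_weight_psi_pow[OF \<psi> \<alpha>])
  have "ennreal (Nd (\<epsilon> * u)) \<le> ?L + (\<Sum>i. ?S i)"
  proof (rule young_version_le[OF \<psi>d Nd True])
    fix p assume p: "\<alpha> \<le> p"
    let ?r = "(\<epsilon> * u / psi_pow d \<psi> p) powr p"
    show "ennreal ?r \<le> ?L + (\<Sum>i. ?S i)"
    proof (cases "p < real P")
      case True
      have 1: "0 < psi_pow d \<psi> \<alpha>" "psi_pow d \<psi> \<alpha> \<le> psi_pow d \<psi> p"
        using \<psi>d p by (auto simp: increasing_weight_def)
      have "(1::real) \<le> 4 ^ d" by simp
      then have "1 \<le> 16 * (4::real) ^ d" by linarith
      then have "\<epsilon> * u \<le> 1 * u" using u by (intro mult_right_mono) (auto simp: \<epsilon>_def)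
      then have "\<epsilon> * u / psi_pow d \<psi> p \<le> u / psi_pow d \<psi> \<alpha>" using 1 u by (intro frac_le) auto
      then have "\<epsilon> * u / psi_pow d \<psi> p \<le> 1 + u / psi_pow d \<psi> \<alpha>" by linarith
      then have "?r \<le> (1 + u / psi_pow d \<psi> \<alpha>) powr p"
        using 1 u p \<alpha> by (intro powr_mono2) (auto simp: \<epsilon>_def)
      also have "\<dots> \<le> (1 + u / psi_pow d \<psi> \<alpha>) powr real P"
        using True 1 u by (intro powr_mono) auto
      also have "\<dots> = (1 + u / psi_pow d \<psi> \<alpha>) ^ P"
        using 1 u by (intro powr_realpow add_pos_nonneg) auto
      finally have "ennreal ?r \<le> ?L" by (rule ennreal_leI)
      then show ?thesis by (rule add_increasing2[rotated]) simp
    next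
      case False
      obtain m :: nat where m: "2 ^ m \<le> p" "p < 2 * 2 ^ m"
        using dyadic_interval[of p] p \<alpha> by auto
      have "m0 \<le> m"
      proof (rule ccontr)
        assume "\<not> m0 \<le> m"
        then have "(2::real) ^ (m + 1) \<le> 2 ^ m0" by (intro power_increasing) auto
        then show False using m False by (simp add: P_def)
      qed
      then obtain i where i: "m = m0 + i" by (metis le_add_diff_inverse)
      have q: "real (q i) \<le> p" "p \<le> 2 * real (q i)" "q i > 0" using m i by (auto simp: q_def)
      have q\<alpha>: "\<alpha> \<le> real (q i)"
      proof -
        have "(2::real) ^ m0 \<le> 2 ^ (m0 + i)" by (intro power_increasing) auto
        then have "\<alpha> \<le> 2 ^ (m0 + i)" using m0 by linarith
        then show ?thesis by (simp add: q_def)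
      qed
      have pos: "0 < \<psi> p" using \<psi> p by (auto simp: increasing_weight_def)
      define v where "v = u / (2 * (4 * real (q i)) ^ d)"
      have v: "0 \<le> v" using u by (simp add: v_def)
      have "\<epsilon> * u / psi_pow d \<psi> p \<le> \<epsilon> * u / (real (q i) ^ d * \<psi> p)"
        unfolding psi_pow_def using u q pos
        by (intro divide_left_mono mult_right_mono power_mono mult_pos_pos zero_less_power) (auto simp: \<epsilon>_def)
      also have "\<dots> = (1 / 8 * v) / \<psi> p"
        by (simp add: v_def \<epsilon>_def power_mult_distrib)
      finally have "?r \<le> ((1 / 8 * v) / \<psi> p) powr p"
        using u p \<alpha> \<psi>d by (intro powr_mono2) (auto simp: \<epsilon>_def increasing_weight_def less_imp_le)
      then have "ennreal ?r \<le> ennreal (((1 / 8 * v) / \<psi> p) powr p)" by (rule ennreal_leI)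
      also have "\<dots> \<le> window_sup \<psi> (q i) (1 / 8 * v)"
        unfolding window_sup_def using q by (intro SUP_upper) auto
      also have "\<dots> \<le> ennreal (max ((1 / 8) ^ q i) ((1 / 8) ^ (2 * q i))) * window_sup \<psi> (q i) v"
        by (rule window_sup_scale[OF \<psi> q\<alpha> q(3)]) (use v in auto)
      also have "max ((1 / 8) ^ q i) ((1 / 8) ^ (2 * q i)) = (1 / 8 :: real) ^ q i"
        by (intro max_absorb1 power_decreasing) auto
      also have "ennreal ((1 / 8) ^ q i) * window_sup \<psi> (q i) v \<le> ?S i"
        unfolding v_def[symmetric]
        by (intro mult_left_mono dyadic_majorant_ge window_sup_scale[OF \<psi> q\<alpha> q(3)] v) auto
      also have "?S i \<le> (\<Sum>i. ?S i)"
        using sum_le_suminf[of ?S "{i}"] by simp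
      finally show ?thesis by (rule add_increasing[rotated]) simp
    qed
  qed
  then show ?thesis by (rule add_increasing[rotated]) simp
qed

lemma power_one_plus_le:
  fixes y :: real
  assumes "0 \<le> y" shows "(1 + y) ^ n \<le> 2 ^ n * (1 + y ^ n)"
proof -
  have "(1 + y) ^ n \<le> (2 * max 1 y) ^ n" using assms by (intro power_mono) auto
  also have "\<dots> = 2 ^ n * max 1 y ^ n" by (rule power_mult_distrib)
  also have "max 1 y ^ n \<le> 1 + y ^ n" using assms by (auto simp: max_def)
  finally show ?thesis by simp
qed

lemma strong_type_mono:
  assumes "strong_type M T p A" "0 \<le> A" "A \<le> B" shows "strong_type M T p B"
  using assms unfolding strong_type_def
  by (auto elim!: order_trans intro!: mult_right_mono ennreal_leI power_mono)


section \<open>The modular inequality\<close>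

text \<open>
  The passage from \<open>L\<^sup>p\<close> bounds of order \<open>p\<^sup>d\<close> to a modular inequality. Integrating the majorant of \<open>N\<^sub>d\<close> term by
  term, interpolation replaces \<open>T f\<close> by \<open>f\<close> in each window, and each window supremum of \<open>\<bar>f\<bar>\<close> is at most \<open>N\<close>, up to
  the value at \<open>e\<^sup>2\<close>; the windows then carry the weights \<open>(4 / 8)\<^sup>q\<close>. The constant \<open>K\<close> precedes all quantifiers over the versions,
  the operator and the function, so it is uniform in \<open>M\<close> when \<open>T\<close> is a partial sum operator.
\<close>

lemma modular_bound:
  fixes d :: nat and \<psi> :: "real \<Rightarrow> real"
  defines "\<epsilon> \<equiv> 1 / (16 * 4 ^ d)"
  assumes \<psi>: "increasing_weight \<alpha> \<psi>" and \<alpha>: "\<alpha> \<ge> 1"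
  shows "\<exists>K\<ge>0. \<forall>N\<in>young_versions \<alpha> \<psi>. \<forall>Nd\<in>young_versions \<alpha> (psi_pow d \<psi>). \<forall>M :: 'a measure. \<forall>T f.
    emeasure M (space M) = 1 \<longrightarrow> subadditive_on_L1 M T \<longrightarrow> (\<forall>k. strong_type M T (2 ^ Suc k) ((2 ^ Suc k) ^ d)) \<longrightarrow>
    f \<in> borel_measurable M \<longrightarrow> (\<integral>\<^sup>+x. ennreal (N (cmod (f x))) \<partial>M) \<le> 1 \<longrightarrow>
    integrable M f \<and> (\<integral>\<^sup>+x. ennreal (Nd (\<epsilon> * cmod (T f x))) \<partial>M) \<le> ennreal K"
proof -
  obtain n where n: "\<alpha> < 2 ^ n" using real_arch_pow[of 2 \<alpha>] by auto
  \<comment> \<open>Windows start at \<open>q \<ge> 4\<close>, so that the smaller interpolation exponent \<open>q / 2\<close> is at least \<open>2\<close>.\<close>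
  define m0 where "m0 = n + 2"
  have "(2::real) ^ n \<le> 2 ^ m0" unfolding m0_def by (intro power_increasing) auto
  with n have "\<alpha> \<le> 2 ^ m0" by linarith
  moreover have "m0 \<ge> 2" by (simp add: m0_def)
  ultimately have m0: "\<alpha> \<le> 2 ^ m0" "m0 \<ge> 2" by auto
  define P :: nat where "P = 2 ^ m0"
  have P: "\<alpha> \<le> real P" "0 < P" using m0(1) by (simp_all add: P_def)
  define q :: "nat \<Rightarrow> nat" where "q = (\<lambda>i. 2 ^ (m0 + i))"
  define Y Yd where "Y = young_at_exp2 \<alpha> \<psi>" and "Yd = young_at_exp2 \<alpha> (psi_pow d \<psi>)"
  have Y: "Y > 0" "Yd > 0" by (auto simp: Y_def Yd_def young_at_exp2_pos)
  have \<psi>d: "increasing_weight \<alpha> (psi_pow d \<psi>)" by (rule increasing_weight_psi_pow[OF \<psi> \<alpha>])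
  define c where "c = psi_pow d \<psi> \<alpha>"
  have c: "c > 0" using \<psi>d by (auto simp: c_def increasing_weight_def)
  have \<psi>P: "\<psi> (real P) > 0" using \<psi> P by (auto simp: increasing_weight_def)
  define E where "E = exp 2 ^ P + \<psi> (real P) ^ P"
  have E: "E > 0" using \<psi>P by (auto simp: E_def intro: add_pos_pos)
  define L where "L = 2 ^ P * (1 + (1 / c ^ P) * ((real P ^ d) ^ P * E))"
  have L: "L \<ge> 0" using c E by (auto simp: L_def)
  define K where "K = Yd + (L + 10 * (Y + 1))"
  have "integrable M f \<and> (\<integral>\<^sup>+x. ennreal (Nd (\<epsilon> * cmod (T f x))) \<partial>M) \<le> ennreal K"
    if N: "N \<in> young_versions \<alpha> \<psi>" and Nd: "Nd \<in> young_versions \<alpha> (psi_pow d \<psi>)"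
      and M1: "emeasure M (space M) = 1" and sub: "subadditive_on_L1 M T"
      and strong: "\<And>k. strong_type M T (2 ^ Suc k) ((2 ^ Suc k) ^ d)"
      and fm: "f \<in> borel_measurable M" and fN: "(\<integral>\<^sup>+x. ennreal (N (cmod (f x))) \<partial>M) \<le> 1"
    for N Nd and M :: "'a measure" and T f
  proof
    interpret finite_measure M by (rule finite_measureI) (simp add: M1)
    note [measurable] = fm young_version_measurable[OF N] young_version_measurable[OF Nd]
    have N0: "0 \<le> N (cmod (f x))" for x by (rule young_version_nonneg[OF N]) simp
    have fP: "(\<integral>\<^sup>+x. ennreal (cmod (f x) ^ P) \<partial>M) \<le> ennreal E"
    proof -
      have "cmod (f x) ^ P \<le> exp 2 ^ P + \<psi> (real P) ^ P * N (cmod (f x))" for x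
      proof (cases "exp 2 \<le> cmod (f x)")
        case True
        then have f0: "cmod (f x) > 0" using exp_gt_zero[of "2::real"] by linarith
        have "(cmod (f x) / \<psi> (real P)) ^ P = (cmod (f x) / \<psi> (real P)) powr real P"
          using f0 \<psi>P by (intro powr_realpow[symmetric]) auto
        also have "\<dots> \<le> N (cmod (f x))"
          by (rule young_version_ge[OF \<psi> \<alpha> N True P(1)])
        finally have "cmod (f x) ^ P \<le> \<psi> (real P) ^ P * N (cmod (f x))"
          using \<psi>P by (simp add: power_divide pos_divide_le_eq mult.commute)
        then show ?thesis by (rule add_increasing[rotated]) simp
      next
        case False
        then have "cmod (f x) ^ P \<le> exp 2 ^ P" by (intro power_mono) auto
        then show ?thesis using N0[of x] \<psi>P by (intro add_increasing2) auto
      qed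
      then have "(\<integral>\<^sup>+x. ennreal (cmod (f x) ^ P) \<partial>M)
          \<le> (\<integral>\<^sup>+x. ennreal (exp 2 ^ P) + ennreal (\<psi> (real P) ^ P) * ennreal (N (cmod (f x))) \<partial>M)"
        using N0 \<psi>P by (intro nn_integral_mono) (simp flip: ennreal_plus ennreal_mult)
      also have "\<dots> = ennreal (exp 2 ^ P) + ennreal (\<psi> (real P) ^ P) * (\<integral>\<^sup>+x. ennreal (N (cmod (f x))) \<partial>M)"
        by (simp add: nn_integral_add nn_integral_cmult M1)
      also have "\<dots> \<le> ennreal (exp 2 ^ P) + ennreal (\<psi> (real P) ^ P) * 1"
        by (intro add_left_mono mult_left_mono fN) auto
      also have "\<dots> = ennreal E" using \<psi>P by (simp add: E_def ennreal_plus)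
      finally show ?thesis .
    qed
    then have "Lp_bounded M P f (root P E)"
      using E P by (simp add: Lp_bounded_def)
    then show int: "integrable M f"
      using P by (intro integrable_of_Lp_bounded) auto
    have Pk: "P = 2 ^ Suc (n + 1)" by (simp add: P_def m0_def)
    have [measurable]: "T f \<in> borel_measurable M"
      using strong[of 0] int by (simp add: strong_type_def)
    define D where "D = (\<lambda>i. dyadic_majorant (q i div 2) (4 * q i) (window_sup \<psi> (q i)))"
    have [measurable]: "D i \<in> borel_measurable borel" for i unfolding D_def by measurable
    define S where "S = (\<lambda>i x. ennreal ((1 / 8) ^ q i) * (window_sup \<psi> (q i) 1 + ennreal (4 ^ q i) *
           D i (cmod (T f x) / (2 * (4 * real (q i)) ^ d))))"
    have S_int: "(\<integral>\<^sup>+x. S i x \<partial>M) \<le> ennreal ((1 / 2) ^ i * (5 * (Y + 1)))" for i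
    proof -
      define A where "A = (4 * real (q i)) ^ d"
      have q: "\<alpha> \<le> real (q i)" "4 \<le> q i"
      proof -
        have "(2::real) ^ m0 \<le> 2 ^ (m0 + i)" by (intro power_increasing) auto
        then have "\<alpha> \<le> 2 ^ (m0 + i)" using m0 by linarith
        then show "\<alpha> \<le> real (q i)" by (simp add: q_def)
        have "(2::nat) ^ 2 \<le> 2 ^ (m0 + i)" using m0 by (intro power_increasing) auto
        then show "4 \<le> q i" by (simp add: q_def)
      qed
      have q2: "q i div 2 = 2 ^ Suc (n + i)" by (simp add: q_def m0_def power_add)
      have q4: "4 * q i = 2 ^ Suc (n + i + 3)" by (simp add: q_def m0_def power_add)
      have A: "A > 0" using q(2) by (simp add: A_def)
      have "strong_type M T (q i div 2) (real (q i div 2) ^ d)" using strong[of "n + i"] by (simp add: q2)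
      moreover have "real (q i div 2) ^ d \<le> A"
        unfolding A_def by (rule power_mono) simp_all
      ultimately have sa: "strong_type M T (q i div 2) A"
        by (rule strong_type_mono[OF _ zero_le_power[OF of_nat_0_le_iff]])
      have "strong_type M T (4 * q i) (real (4 * q i) ^ d)" 
        unfolding q4 of_nat_power of_nat_numeral by (rule strong)
      then have sb: "strong_type M T (4 * q i) A" unfolding A_def by (simp only: of_nat_mult of_nat_numeral)
      note F = window_sup_scale[OF \<psi> q(1)]
      have "(\<integral>\<^sup>+x. D i (cmod (T f x) / (2 * A)) \<partial>M) \<le> (\<integral>\<^sup>+x. D i (cmod (f x)) \<partial>M)"
        unfolding D_def using q(2) by (intro nn_integral_dyadic_majorant_le[OF sub sa sb _ _ A int]) auto
      also have "\<dots> \<le> (\<integral>\<^sup>+x. ennreal (4 * Y) + 4 * ennreal (N (cmod (f x))) \<partial>M)"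
      proof (rule nn_integral_mono)
        fix x
        have "D i (cmod (f x)) \<le> 4 * window_sup \<psi> (q i) (cmod (f x))"
          unfolding D_def using q(2) by (intro dyadic_majorant_le[OF F]) auto
        also have "\<dots> \<le> 4 * ennreal (N (max (cmod (f x)) (exp 2)))"
          by (intro mult_left_mono window_sup_le_young[OF \<psi> \<alpha> N q(1)]) auto
        also have "\<dots> \<le> 4 * ennreal (Y + N (cmod (f x)))"
          unfolding Y_def by (intro mult_left_mono ennreal_leI young_max_exp2_le[OF N]) auto
        also have "\<dots> = ennreal (4 * Y) + 4 * ennreal (N (cmod (f x)))"
          using Y N0[of x] by (simp add: ennreal_plus ennreal_mult' distrib_left)
        finally show "D i (cmod (f x)) \<le> ennreal (4 * Y) + 4 * ennreal (N (cmod (f x)))" .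
      qed
      also have "\<dots> = ennreal (4 * Y) + 4 * (\<integral>\<^sup>+x. ennreal (N (cmod (f x))) \<partial>M)"
        by (simp add: nn_integral_add nn_integral_cmult M1)
      also have "\<dots> \<le> ennreal (4 * Y) + 4 * 1"
        by (intro add_left_mono mult_left_mono fN) auto
      also have "\<dots> = ennreal (4 * (Y + 1))"
        using Y by (simp add: ennreal_plus distrib_left)
      finally have DT: "(\<integral>\<^sup>+x. D i (cmod (T f x) / (2 * A)) \<partial>M) \<le> ennreal (4 * (Y + 1))" .
      have F1: "window_sup \<psi> (q i) 1 \<le> ennreal Y"
        using window_sup_le_young[OF \<psi> \<alpha> N q(1), of 1] young_version_exp2[OF N]
        by (simp add: Y_def max_def)
      have "(\<integral>\<^sup>+x. S i x \<partial>M) = ennreal ((1 / 8) ^ q i) * (window_sup \<psi> (q i) 1 + ennreal (4 ^ q i) *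
           (\<integral>\<^sup>+x. D i (cmod (T f x) / (2 * A)) \<partial>M))"
        unfolding S_def A_def by (simp add: nn_integral_cmult nn_integral_add M1)
      also have "\<dots> \<le> ennreal ((1 / 8) ^ q i) * (ennreal Y + ennreal (4 ^ q i) * ennreal (4 * (Y + 1)))"
        by (intro mult_left_mono add_mono DT F1) auto
      also have "\<dots> = ennreal ((1 / 8) ^ q i * (Y + 4 ^ q i * (4 * (Y + 1))))"
        using Y by (simp flip: ennreal_plus ennreal_mult)
      also have "\<dots> \<le> ennreal ((1 / 2) ^ i * (5 * (Y + 1)))"
      proof (rule ennreal_leI)
        have "1 \<le> (4::real) ^ q i" by simp
        then have "1 * Y \<le> 4 ^ q i * Y" using Y by (intro mult_right_mono) auto
        also have "\<dots> \<le> 4 ^ q i * (Y + 1)" by simp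
        finally have "Y + 4 ^ q i * (4 * (Y + 1)) \<le> 4 ^ q i * (5 * (Y + 1))" by linarith
        then have "(1 / 8) ^ q i * (Y + 4 ^ q i * (4 * (Y + 1))) \<le> (1 / 8) ^ q i * (4 ^ q i * (5 * (Y + 1)))"
          by (rule mult_left_mono) simp
        also have "\<dots> = (1 / 2) ^ q i * (5 * (Y + 1))"
          unfolding mult.assoc[symmetric] power_mult_distrib[symmetric] by simp
        also have "\<dots> \<le> (1 / 2) ^ i * (5 * (Y + 1))"
        proof (intro mult_right_mono power_decreasing)
          have "i < 2 ^ i" by (rule less_exp)
          also have "(2::nat) ^ i \<le> q i" unfolding q_def by (intro power_increasing) auto
          finally show "i \<le> q i" by simp
        qed (use Y in auto)
        finally show "(1 / 8) ^ q i * (Y + 4 ^ q i * (4 * (Y + 1))) \<le> (1 / 2) ^ i * (5 * (Y + 1))" .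
      qed
      finally show ?thesis .
    qed
    have low: "(\<integral>\<^sup>+x. ennreal ((1 + cmod (T f x) / c) ^ P) \<partial>M) \<le> ennreal L"
    proof -
      have "(\<integral>\<^sup>+x. ennreal ((1 + cmod (T f x) / c) ^ P) \<partial>M)
          \<le> (\<integral>\<^sup>+x. ennreal (2 ^ P) * (1 + ennreal (1 / c ^ P) * ennreal (cmod (T f x) ^ P)) \<partial>M)"
      proof (rule nn_integral_mono)
        fix x
        have "(1 + cmod (T f x) / c) ^ P \<le> 2 ^ P * (1 + (cmod (T f x) / c) ^ P)"
          using c by (intro power_one_plus_le) auto
        also have "\<dots> = 2 ^ P * (1 + 1 / c ^ P * cmod (T f x) ^ P)" by (simp add: power_divide)
        finally have "ennreal ((1 + cmod (T f x) / c) ^ P) \<le> ennreal (2 ^ P * (1 + 1 / c ^ P * cmod (T f x) ^ P))"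
          by (rule ennreal_leI)
        also have "\<dots> = ennreal (2 ^ P) * ennreal (1 + 1 / c ^ P * cmod (T f x) ^ P)"
          by (rule ennreal_mult) (use c in auto)
        also have "ennreal (1 + 1 / c ^ P * cmod (T f x) ^ P) = ennreal 1 + ennreal (1 / c ^ P * cmod (T f x) ^ P)"
          by (rule ennreal_plus) (use c in auto)
        also have "ennreal (1 / c ^ P * cmod (T f x) ^ P) = ennreal (1 / c ^ P) * ennreal (cmod (T f x) ^ P)"
          by (rule ennreal_mult) (use c in auto)
        finally show "ennreal ((1 + cmod (T f x) / c) ^ P)
            \<le> ennreal (2 ^ P) * (1 + ennreal (1 / c ^ P) * ennreal (cmod (T f x) ^ P))" by simp
      qed
      also have "\<dots> = ennreal (2 ^ P) * (1 + ennreal (1 / c ^ P) * (\<integral>\<^sup>+x. ennreal (cmod (T f x) ^ P) \<partial>M))"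
        by (simp add: nn_integral_add nn_integral_cmult M1)
      also have "\<dots> \<le> ennreal (2 ^ P) * (1 + ennreal (1 / c ^ P) * (ennreal ((real P ^ d) ^ P) * ennreal E))"
      proof (intro mult_left_mono add_left_mono)
        have "(\<integral>\<^sup>+x. ennreal (cmod (T f x) ^ P) \<partial>M) \<le> ennreal ((real P ^ d) ^ P) * (\<integral>\<^sup>+x. ennreal (cmod (f x) ^ P) \<partial>M)"
          using strong[of "n + 1"] int unfolding Pk strong_type_def by simp
        also have "\<dots> \<le> ennreal ((real P ^ d) ^ P) * ennreal E"
          by (intro mult_left_mono fP) auto
        finally show "(\<integral>\<^sup>+x. ennreal (cmod (T f x) ^ P) \<partial>M) \<le> ennreal ((real P ^ d) ^ P) * ennreal E" .
      qed auto
      also have "\<dots> = ennreal L"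
      proof -
        have "ennreal L = ennreal (2 ^ P) * ennreal (1 + (1 / c ^ P) * ((real P ^ d) ^ P * E))"
          unfolding L_def by (rule ennreal_mult) (use c E in auto)
        also have "ennreal (1 + (1 / c ^ P) * ((real P ^ d) ^ P * E)) = ennreal 1 + ennreal ((1 / c ^ P) * ((real P ^ d) ^ P * E))"
          by (rule ennreal_plus) (use c E in auto)
        also have "ennreal ((1 / c ^ P) * ((real P ^ d) ^ P * E)) = ennreal (1 / c ^ P) * ennreal ((real P ^ d) ^ P * E)"
          by (rule ennreal_mult) (use c E in auto)
        also have "ennreal ((real P ^ d) ^ P * E) = ennreal ((real P ^ d) ^ P) * ennreal E"
          by (rule ennreal_mult) (use E in auto)
        finally show ?thesis by simp
      qed
      finally show ?thesis .
    qed
    have "(\<integral>\<^sup>+x. ennreal (Nd (\<epsilon> * cmod (T f x))) \<partial>M)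
        \<le> (\<integral>\<^sup>+x. ennreal Yd + (ennreal ((1 + cmod (T f x) / c) ^ P) + (\<Sum>i. S i x)) \<partial>M)"
      unfolding Yd_def c_def S_def D_def q_def P_def \<epsilon>_def
      by (intro nn_integral_mono psi_pow_young_version_le \<psi> \<alpha> Nd m0) simp
    also have "\<dots> = ennreal Yd + ((\<integral>\<^sup>+x. ennreal ((1 + cmod (T f x) / c) ^ P) \<partial>M) + (\<Sum>i. \<integral>\<^sup>+x. S i x \<partial>M))"
    proof -
      have [measurable]: "S i \<in> borel_measurable M" for i unfolding S_def by measurable
      show ?thesis by (simp add: nn_integral_add nn_integral_suminf M1)
    qed
    also have "\<dots> \<le> ennreal Yd + (ennreal L + ennreal (10 * (Y + 1)))"
    proof (intro add_left_mono add_mono low)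
      have "(\<lambda>i. (1 / 2) ^ i * (5 * (Y + 1))) sums (2 * (5 * (Y + 1)))"
      proof (rule sums_mult2)
        show "(\<lambda>i. (1 / 2 :: real) ^ i) sums 2" using geometric_sums[of "1 / 2 :: real"] by simp
      qed
      then have "(\<Sum>i. ennreal ((1 / 2) ^ i * (5 * (Y + 1)))) = ennreal (10 * (Y + 1))"
        using Y by (intro suminf_ennreal_eq) auto
      moreover have "(\<Sum>i. \<integral>\<^sup>+x. S i x \<partial>M) \<le> (\<Sum>i. ennreal ((1 / 2) ^ i * (5 * (Y + 1))))"
        by (intro suminf_le summableI S_int)
      ultimately show "(\<Sum>i. \<integral>\<^sup>+x. S i x \<partial>M) \<le> ennreal (10 * (Y + 1))" by simp
    qed
    also have "\<dots> = ennreal K" using Y L by (simp add: K_def flip: ennreal_plus)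
    finally show "(\<integral>\<^sup>+x. ennreal (Nd (\<epsilon> * cmod (T f x))) \<partial>M) \<le> ennreal K" .
  qed
  moreover have "K \<ge> 0" using Y L by (simp add: K_def)
  ultimately show ?thesis by blast
qed

section \<open>Orlicz norms of partial sums\<close>

text \<open>
  Convexity and \<open>N 0 = 0\<close> convert the infimum in the Orlicz norm into the Luxemburg form: if the quotient
  at \<open>v\<close> is below \<open>A\<close>, the integral at \<open>v \<bar>f\<bar>\<close> is at most \<open>A v\<close>, and shrinking the argument by the factor
  \<open>1 / (A v) \<le> 1\<close> shrinks the integral by at least the same factor.
\<close>

lemma nn_integral_young_le_1:
  assumes N: "N \<in> young_versions \<alpha> \<rho>" and f: "f \<in> borel_measurable M" and A: "A > 0"
    and norm: "orlicz_norm M N f < ennreal A"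
  shows "(\<integral>\<^sup>+x. ennreal (N (cmod (f x) / A)) \<partial>M) \<le> 1"
proof -
  note [measurable] = f young_version_measurable[OF N]
  obtain v where v: "v > 0" "(1 + (\<integral>\<^sup>+x. ennreal (N (v * cmod (f x))) \<partial>M)) / ennreal v < ennreal A"
    using norm unfolding orlicz_norm_def INF_less_iff by auto
  define I where "I = (\<integral>\<^sup>+x. ennreal (N (v * cmod (f x))) \<partial>M)"
  have "1 + I \<le> ennreal A * ennreal v"
  proof -
    have "(1 + I) = (1 + I) / ennreal v * ennreal v"
      using v(1) by (simp add: ennreal_divide_times ennreal_times_divide mult_divide_eq_ennreal)
    also have "\<dots> \<le> ennreal A * ennreal v"
      using v(2) by (intro mult_right_mono) (auto simp: I_def)
    finally show ?thesis .
  qed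
  also have "\<dots> = ennreal (A * v)" using A v by (simp add: ennreal_mult)
  finally have AV: "1 + I \<le> ennreal (A * v)" .
  have "ennreal 1 \<le> ennreal (A * v)" by (rule order_trans[OF _ AV]) simp
  then have Av: "1 \<le> A * v" by (subst (asm) ennreal_le_iff) (use A v in auto)
  have I: "I \<le> ennreal (A * v)" by (rule order_trans[OF _ AV]) simp
  define t where "t = 1 / (A * v)"
  have t: "0 \<le> t" "t \<le> 1" "t * v = 1 / A" using Av A v by (auto simp: t_def)
  have "(\<integral>\<^sup>+x. ennreal (N (cmod (f x) / A)) \<partial>M) \<le> (\<integral>\<^sup>+x. ennreal t * ennreal (N (v * cmod (f x))) \<partial>M)"
  proof (rule nn_integral_mono)
    fix x
    have "N (cmod (f x) / A) = N (t * (v * cmod (f x)))"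
      using t(3) by (simp flip: mult.assoc)
    also have "\<dots> \<le> t * N (v * cmod (f x))" by (rule young_version_scale[OF N t(1,2)])
    finally show "ennreal (N (cmod (f x) / A)) \<le> ennreal t * ennreal (N (v * cmod (f x)))"
      using t(1) by (simp add: ennreal_leI flip: ennreal_mult')
  qed
  also have "\<dots> = ennreal t * I" by (simp add: I_def nn_integral_cmult)
  also have "\<dots> \<le> ennreal t * ennreal (A * v)" by (intro mult_left_mono I) simp
  also have "\<dots> = 1" using A v by (simp add: t_def flip: ennreal_mult')
  finally show ?thesis .
qed

lemma orlicz_norm_le:
  assumes "v > 0" "(\<integral>\<^sup>+x. ennreal (N (v * cmod (f x))) \<partial>M) \<le> ennreal K" "K \<ge> 0"
  shows "orlicz_norm M N f \<le> ennreal ((1 + K) / v)"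
proof -
  have "orlicz_norm M N f \<le> (1 + (\<integral>\<^sup>+x. ennreal (N (v * cmod (f x))) \<partial>M)) / ennreal v"
    unfolding orlicz_norm_def using assms by (intro INF_lower) auto
  also have "\<dots> \<le> (1 + ennreal K) / ennreal v"
    by (intro divide_right_mono_ennreal add_left_mono assms)
  also have "\<dots> = ennreal ((1 + K) / v)"
    using assms by (simp add: divide_ennreal flip: ennreal_1 ennreal_plus)
  finally show ?thesis .
qed

lemma integrable_times_character:
  assumes "integrable torus f" shows "integrable torus (\<lambda>x. f x * cnj (character n x))"
proof (rule Bochner_Integration.integrable_bound[OF assms])
  show "(\<lambda>x. f x * cnj (character n x)) \<in> borel_measurable torus"
    using character_torus[of n] borel_measurable_integrable[OF assms] by measurable
qed (simp add: norm_mult)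

lemma partial_sum_add:
  assumes "integrable torus f" "integrable torus g"
  shows "partial_sum M (\<lambda>y. f y + g y) x = partial_sum M f x + partial_sum M g x"
  using assms by (simp add: partial_sum_eq fourier_coeff_eq distrib_right integrable_times_character sum.distrib)

lemma partial_sum_scale: "partial_sum M (\<lambda>y. c * f y) x = c * partial_sum M f x"
  by (simp add: partial_sum_eq fourier_coeff_eq mult.assoc sum_distrib_left)

lemma subadditive_partial_sum: "subadditive_on_L1 torus (partial_sum M)"
  by (simp add: subadditive_on_L1_def partial_sum_add norm_triangle_ineq)

text \<open>
  The bound \<open>Lp_bounded_partial_sum\<close> is stated for positive numbers \<open>a\<close>, so \<open>a\<close> is taken slightly above the norm
  of \<open>g\<close>; this covers a vanishing norm as well.
\<close>

lemma strong_type_partial_sum: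
  "strong_type (torus :: (real ^ 'd) measure) (partial_sum M) (2 ^ Suc k) ((2 ^ Suc k) ^ CARD('d))"
  unfolding strong_type_def
proof (intro allI impI conjI partial_sum_measurable)
  fix g :: "real ^ 'd \<Rightarrow> complex" assume "integrable torus g"
  then have g: "g \<in> borel_measurable torus" by simp
  let ?p = "2 ^ Suc k :: nat" and ?C = "(2 ^ Suc k) ^ CARD('d) :: real"
  let ?I = "\<lambda>f. \<integral>\<^sup>+x. ennreal (cmod (f x) ^ ?p) \<partial>(torus :: (real ^ 'd) measure)"
  show "?I (partial_sum M g) \<le> ennreal (?C ^ ?p) * ?I g"
  proof (cases "?I g")
    case (real X)
    have "?I (partial_sum M g) \<le> ennreal (?C ^ ?p * X) + ennreal e" if e: "e > 0" for e
    proof -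
      define \<delta> where "\<delta> = e / ?C ^ ?p"
      have \<delta>: "\<delta> > 0" using e by (simp add: \<delta>_def)
      define a where "a = root ?p (X + \<delta>)"
      have a: "a > 0" "a ^ ?p = X + \<delta>" using \<delta> real by (auto simp: a_def)
      have "Lp_bounded torus ?p g a"
        unfolding Lp_bounded_def a(2) using g real \<delta> by (auto intro!: ennreal_leI)
      from Lp_bounded_D[OF Lp_bounded_partial_sum[OF a(1) this]]
      have "?I (partial_sum M g) \<le> ennreal ((?C * a) ^ ?p)" .
      also have "(?C * a) ^ ?p = ?C ^ ?p * X + e"
        unfolding power_mult_distrib[of ?C a] a(2) by (simp add: \<delta>_def distrib_left)
      finally show ?thesis using real e by (simp add: ennreal_plus)
    qed
    then have "?I (partial_sum M g) \<le> ennreal (?C ^ ?p * X)" by (rule ennreal_le_epsilon)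
    also have "\<dots> = ennreal (?C ^ ?p) * ennreal X" by (rule ennreal_mult) (use real in auto)
    finally show ?thesis unfolding real(2) .
  next
    case top
    have "ennreal (?C ^ ?p) \<noteq> 0" by (simp only: ennreal_eq_0_iff not_le) (intro zero_less_power, simp)
    then show ?thesis unfolding top by (simp only: ennreal_mult_top if_False top_greatest)
  qed
qed


theorem theorem1:
  fixes \<alpha> :: real and \<psi> :: "real \<Rightarrow> real"
  assumes "\<alpha> \<ge> 1" and "\<psi> \<in> Psi_class \<alpha>"
  shows "\<exists>C::real. C \<ge> 0 \<and>
    (\<forall>N \<in> young_versions \<alpha> \<psi>. \<forall>Nd \<in> young_versions \<alpha> (psi_pow CARD('d) \<psi>).
      \<forall>f :: real ^ 'd::finite \<Rightarrow> complex. f \<in> orlicz_space torus N \<longrightarrow>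
        (\<forall>M\<ge>1. partial_sum M f \<in> orlicz_space torus Nd) \<and>
        (SUP M\<in>{1..}. orlicz_norm torus Nd (partial_sum M f))
          \<le> ennreal C * orlicz_norm torus N f)"
proof -
  define \<epsilon> :: real where "\<epsilon> = 1 / (16 * 4 ^ CARD('d))"
  have \<epsilon>: "\<epsilon> > 0" by (simp add: \<epsilon>_def)
  obtain K where K: "K \<ge> 0" and modular: "\<forall>N\<in>young_versions \<alpha> \<psi>. \<forall>Nd\<in>young_versions \<alpha> (psi_pow CARD('d) \<psi>).
      \<forall>g :: real ^ 'd \<Rightarrow> complex. \<forall>M. g \<in> borel_measurable torus \<longrightarrow>
        (\<integral>\<^sup>+x. ennreal (N (cmod (g x))) \<partial>torus) \<le> 1 \<longrightarrow>
        (\<integral>\<^sup>+x. ennreal (Nd (\<epsilon> * cmod (partial_sum M g x))) \<partial>torus) \<le> ennreal K"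
    using modular_bound[OF increasing_weight_Psi[OF assms(2)] assms(1), of "CARD('d)", where 'a = "real ^ 'd", folded \<epsilon>_def]
      emeasure_torus[where 'd = 'd] subadditive_partial_sum strong_type_partial_sum[where 'd = 'd]
    by metis
  define C where "C = (1 + K) / \<epsilon>"
  have C: "C \<ge> 0" using K \<epsilon> by (simp add: C_def)
  have bound: "orlicz_norm torus Nd (partial_sum M f) \<le> ennreal C * orlicz_norm torus N f"
    if N: "N \<in> young_versions \<alpha> \<psi>" and Nd: "Nd \<in> young_versions \<alpha> (psi_pow CARD('d) \<psi>)"
      and f: "f \<in> orlicz_space torus N"
    for N Nd M and f :: "real ^ 'd \<Rightarrow> complex"
  proof -
    have [measurable]: "f \<in> borel_measurable torus" using f by (simp add: orlicz_space_def)
    have "orlicz_norm torus N f < \<infinity>" using f by (simp add: orlicz_space_def)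
    then obtain r where r: "r \<ge> 0" "orlicz_norm torus N f = ennreal r"
      by (cases "orlicz_norm torus N f") auto
    have "orlicz_norm torus Nd (partial_sum M f) \<le> ennreal (C * r) + ennreal e" if e: "e > 0" for e
    proof -
      \<comment> \<open>Any \<open>A\<close> above the norm works; with this excess \<open>C A\<close> is at most \<open>C r + e\<close>.\<close>
      define A where "A = r + e / (C + 1)"
      have A: "A > 0" "r < A" using e C r by (auto simp: A_def intro: add_nonneg_pos)
      define g where "g = (\<lambda>x. complex_of_real (1 / A) * f x)"
      have gm: "g \<in> borel_measurable torus" unfolding g_def by measurable
      have Tg: "cmod (partial_sum M g x) = cmod (partial_sum M f x) / A" for x
        unfolding g_def partial_sum_scale using A by (simp add: norm_mult norm_divide)
      have "(\<integral>\<^sup>+x. ennreal (N (cmod (f x) / A)) \<partial>torus) \<le> 1"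
        using A r by (intro nn_integral_young_le_1[OF N]) (auto intro: ennreal_lessI)
      moreover have "cmod (g x) = cmod (f x) / A" for x using A by (simp add: g_def norm_mult norm_divide)
      ultimately have "(\<integral>\<^sup>+x. ennreal (N (cmod (g x))) \<partial>torus) \<le> 1" by simp
      with modular N Nd gm
      have "(\<integral>\<^sup>+x. ennreal (Nd (\<epsilon> * cmod (partial_sum M g x))) \<partial>torus) \<le> ennreal K"
        by blast
      then have "(\<integral>\<^sup>+x. ennreal (Nd (\<epsilon> / A * cmod (partial_sum M f x))) \<partial>torus) \<le> ennreal K"
        by (simp add: Tg)
      then have "orlicz_norm torus Nd (partial_sum M f) \<le> ennreal ((1 + K) / (\<epsilon> / A))"
        using A \<epsilon> K by (intro orlicz_norm_le) auto
      also have "(1 + K) / (\<epsilon> / A) = C * A" by (simp add: C_def)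
      also have "\<dots> = C * r + C / (C + 1) * e" by (simp add: A_def distrib_left)
      also have "\<dots> \<le> C * r + 1 * e"
        using C e by (intro add_left_mono mult_right_mono) auto
      finally show ?thesis
        using C r e by (simp add: ennreal_leI flip: ennreal_plus)
    qed
    then have "orlicz_norm torus Nd (partial_sum M f) \<le> ennreal (C * r)" by (rule ennreal_le_epsilon)
    then show ?thesis using r C by (simp add: ennreal_mult)
  qed
  have "partial_sum M f \<in> orlicz_space torus Nd"
    if "N \<in> young_versions \<alpha> \<psi>" "Nd \<in> young_versions \<alpha> (psi_pow CARD('d) \<psi>)" "f \<in> orlicz_space torus N"
    for N Nd M and f :: "real ^ 'd \<Rightarrow> complex"
  proof -
    have "ennreal C * orlicz_norm torus N f < \<infinity>"
      using that(3) by (simp add: orlicz_space_def ennreal_mult_less_top)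
    then show ?thesis
      using bound[OF that, of M] by (simp add: orlicz_space_def partial_sum_measurable le_less_trans)
  qed
  then show ?thesis using C bound by (intro exI[of _ C]) (auto intro!: SUP_least)
qed

end
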